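(* Let $\epsilon\ge 0$ and let $M$ and $N$ be $\epsilon$-interleaved pointwise finite dimensional block decomposable modules. Then there exists a matching $\chi:\mathcal B(M)\nrightarrow\mathcal B(N)$ that matches each block in $$\mathcal B(M)^{\mathbf c}\cup \mathcal B(M)^{\mathbf o}_{5\epsilon}\cup\mathcal B(M)^{\mathbf{co}}_{2\epsilon}\cup\mathcal B(M)^{\mathbf{oc}}_{2\epsilon}\quad\text{and each block in}\quad \mathcal B(N)^{\mathbf c}\cup \mathcal B(N)^{\mathbf o}_{5\epsilon}\cup\mathcal B(N)^{\mathbf{co}}_{2\epsilon}\cup\mathcal B(N)^{\mathbf{oc}}_{2\epsilon},$$ and such that if $\chi(\mathcal I)=\mathcal J$, then $\mathcal I$ and $\mathcal J$ are $\epsilon$-interleaved and of the same type. In particular, $\chi$ is a $\tfrac52\epsilon$-matching.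
   Context: Fix a field $k$. For a poset $P$, a $P$-indexed module is a functor $M:P\to \mathrm{Vec}_k$, with vector spaces $M_a$ and internal maps $\varphi_M(a,b):M_a\to M_b$ for $a\le b$; it is pointwise finite dimensional (p.f.d.) if every $M_a$ is finite dimensional. Morphisms are natural transformations. An interval of $P$ is a nonempty subset $\mathcal J$ that is convex ($a\le b\le c$, $a,c\in\mathcal J\Rightarrow b\in\mathcal J$) and connected (any two elements are joined by a finite sequence in $\mathcal J$ of consecutively comparable elements). $I^{\mathcal J}$ is the module equal to $k$ on $\mathcal J$ and $0$ elsewhere, with identity maps between points of $\mathcal J$ and zero maps otherwise. If $M\cong\bigoplus_{\mathcal J\in\mathcal B(M)}I^{\mathcal J}$ for a multiset $\mathcal B(M)$ of intervals, $M$ is interval decomposable and $\mathcal B(M)$ (which is unique) is its barcode. In $\mathbb R^{op}\times\mathbb R$, $(a,b)\le(c,d)$ iff $c\le a$ and $b\le d$. $\mathbb U$ is the sub-poset of pairs $(a,b)$ with $a\le b$. A $\mathbb U$-indexed module is regarded as an $\mathbb R^{op}\times\mathbb R$-indexed module by extending by $0$ outside $\mathbb U$. For an $\mathbb R^{op}\times\mathbb R$-indexed module $M$ and $\epsilon\ge0$, $M(\epsilon)$ is the shifted module $M(\epsilon)_{(s,t)}=M_{(s-\epsilon,t+\epsilon)}$, and $\varphi_M^\epsilon:M\to M(\epsilon)$ is given by internal maps. $M$ and $N$ are $\epsilon$-interleaved if there are morphisms $f:M\to N(\epsilon)$, $g:N\to M(\epsilon)$ with $g(\epsilon)\circ f=\varphi_M^{2\epsilon}$,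 $f(\epsilon)\circ g=\varphi_N^{2\epsilon}$. $M$ is $\epsilon$-trivial if $\varphi_M^\epsilon=0$. Intervals $\mathcal J,\mathcal K$ are $\epsilon$-interleaved (resp. $\mathcal J$ is $\epsilon$-trivial) if $I^{\mathcal J},I^{\mathcal K}$ are (resp. $I^{\mathcal J}$ is). For a barcode (multiset of intervals) $\mathcal C$, $\mathcal C_\epsilon$ is the sub-multiset of intervals that are not $\epsilon$-trivial. A matching $\sigma:S\nrightarrow T$ of multisets is a bijection from a sub-multiset $\mathrm{coim}\,\sigma\subseteq S$ to a sub-multiset $\mathrm{im}\,\sigma\subseteq T$; it matches the elements of $\mathrm{coim}\,\sigma$ and $\mathrm{im}\,\sigma$. An $\epsilon$-matching of barcodes $\mathcal C,\mathcal D$ is a matching $\sigma:\mathcal C\nrightarrow\mathcal D$ with $\mathcal C_{2\epsilon}\subseteq\mathrm{coim}\,\sigma$, $\mathcal D_{2\epsilon}\subseteq\mathrm{im}\,\sigma$, and $\mathcal J,\mathcal K$ $\epsilon$-interleaved whenever $\sigma(\mathcal J)=\mathcal K$. Blocks are the following intervals of $\mathbb U$: $(a,b)_{BL}=\{(x,y)\in\mathbb U: a<x,\ y<b\}$ for $a<b\in\mathbb R\cup\{\pm\infty\}$; $[a,b)_{BL}=\{(x,y)\in\mathbb U: a\le y<b\}$ for $a\in\mathbb R$, $a<b\le\infty$; $(a,b]_{BL}=\{(x,y)\in\mathbb U: a<x\le b\}$ for $b\in\mathbb R$, $-\infty\le a<b$; $[a,b]_{BL}=\{(x,y)\in\mathbb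 U: x\le b,\ y\ge a\}$ for all $a,b\in\mathbb R$ (including $a>b$). Types: type $\mathbf o$: $(a,b)_{BL}$ with $a<b\in\mathbb R$. Type $\mathbf{co}$: $[a,b)_{BL}$ with $a<b\in\mathbb R$, and $(-\infty,b)_{BL}$ with $b\in\mathbb R$. Type $\mathbf{oc}$: $(a,b]_{BL}$ with $a<b\in\mathbb R$, and $(a,\infty)_{BL}$ with $a\in\mathbb R$. Type $\mathbf c$: $[a,b]_{BL}$ with $a,b\in\mathbb R$, $[a,\infty)_{BL}$, $(-\infty,b]_{BL}$, and $(-\infty,\infty)_{BL}$. For a multiset $\mathcal B$ of blocks, $\mathcal B^\star$ is the sub-multiset of blocks of type $\star$, and $\mathcal B^\star_\epsilon=(\mathcal B^\star)_\epsilon$. A module is block decomposable if it is interval decomposable and all intervals in its barcode are blocks. *)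

theory Defs
  imports
    "HOL-Library.Extended_Real"
    "HOL-Library.Dual_Ordered_Lattice"
    "HOL-Library.Product_Order"
    "HOL-Library.Function_Algebras"
begin

section \<open>Modules indexed by a poset\<close>

text \<open>
  The field is the type \<open>'k\<close>, the index poset is a subset \<open>P\<close> of an ordered type \<open>'p\<close>.
  The spaces of a module are subspaces of a common ambient vector space \<open>'v\<close> with scalar
  multiplication \<open>scl\<close>.  This is no restriction up to isomorphism, since every family of vector
  spaces embeds into its direct sum.  Values of \<open>sp\<close> outside \<open>P\<close>, of \<open>imap a b\<close> for
  \<open>a \<le> b\<close> failing in \<open>P\<close>, and of \<open>imap a b\<close> outside \<open>sp a\<close> are irrelevant.
\<close>

record ('p, 'k, 'v) pmod =
  scl :: "'k \<Rightarrow> 'v \<Rightarrow> 'v"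
  sp :: "'p \<Rightarrow> 'v set"
  imap :: "'p \<Rightarrow> 'p \<Rightarrow> 'v \<Rightarrow> 'v"

definition linear_between ::
  "('k \<Rightarrow> 'v \<Rightarrow> 'v) \<Rightarrow> 'v::ab_group_add set \<Rightarrow> ('k \<Rightarrow> 'w \<Rightarrow> 'w) \<Rightarrow> 'w::ab_group_add set
    \<Rightarrow> ('v \<Rightarrow> 'w) \<Rightarrow> bool" where
  "linear_between s V t W f \<longleftrightarrow>
     (\<forall>v\<in>V. f v \<in> W) \<and>
     (\<forall>v\<in>V. \<forall>v'\<in>V. f (v + v') = f v + f v') \<and>
     (\<forall>c. \<forall>v\<in>V. f (s c v) = t c (f v))"

definition persistence_module ::
  "'p::order set \<Rightarrow> ('p, 'k::field, 'v::ab_group_add) pmod \<Rightarrow> bool" where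
  "persistence_module P M \<longleftrightarrow>
     vector_space (scl M) \<and>
     (\<forall>a\<in>P. module.subspace (scl M) (sp M a)) \<and>
     (\<forall>a\<in>P. \<forall>b\<in>P. a \<le> b \<longrightarrow> linear_between (scl M) (sp M a) (scl M) (sp M b) (imap M a b)) \<and>
     (\<forall>a\<in>P. \<forall>v\<in>sp M a. imap M a a v = v) \<and>
     (\<forall>a\<in>P. \<forall>b\<in>P. \<forall>c\<in>P. a \<le> b \<longrightarrow> b \<le> c \<longrightarrow>
        (\<forall>v\<in>sp M a. imap M b c (imap M a b v) = imap M a c v))"

definition pfd :: "'p::order set \<Rightarrow> ('p, 'k::field, 'v::ab_group_add) pmod \<Rightarrow> bool" where
  "pfd P M \<longleftrightarrow> (\<forall>a\<in>P. \<exists>S. finite S \<and> module.span (scl M) S = sp M a)"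

definition morphism ::
  "'p::order set \<Rightarrow> ('p, 'k::field, 'v::ab_group_add) pmod \<Rightarrow> ('p, 'k, 'w::ab_group_add) pmod
    \<Rightarrow> ('p \<Rightarrow> 'v \<Rightarrow> 'w) \<Rightarrow> bool" where
  "morphism P M N f \<longleftrightarrow>
     (\<forall>a\<in>P. linear_between (scl M) (sp M a) (scl N) (sp N a) (f a)) \<and>
     (\<forall>a\<in>P. \<forall>b\<in>P. a \<le> b \<longrightarrow> (\<forall>v\<in>sp M a. f b (imap M a b v) = imap N a b (f a v)))"

definition isomorphic ::
  "'p::order set \<Rightarrow> ('p, 'k::field, 'v::ab_group_add) pmod \<Rightarrow> ('p, 'k, 'w::ab_group_add) pmod
    \<Rightarrow> bool" where
  "isomorphic P M N \<longleftrightarrow>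
     (\<exists>f g. morphism P M N f \<and> morphism P N M g \<and>
        (\<forall>a\<in>P. \<forall>v\<in>sp M a. g a (f a v) = v) \<and>
        (\<forall>a\<in>P. \<forall>w\<in>sp N a. f a (g a w) = w))"

text \<open>Elements of the direct sum over \<open>I\<close> are finitely supported functions vanishing off \<open>I\<close>.\<close>

definition direct_sum ::
  "'i set \<Rightarrow> ('i \<Rightarrow> ('p, 'k::field, 'v::ab_group_add) pmod) \<Rightarrow> ('p, 'k, 'i \<Rightarrow> 'v) pmod" where
  "direct_sum I F =
     \<lparr>scl = (\<lambda>c u i. scl (F i) c (u i)),
      sp = (\<lambda>a. {u. finite {i. u i \<noteq> 0} \<and> (\<forall>i\<in>I. u i \<in> sp (F i) a) \<and> (\<forall>i. i \<notin> I \<longrightarrow> u i = 0)}),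
      imap = (\<lambda>a b u i. if i \<in> I then imap (F i) a b (u i) else 0)\<rparr>"

text \<open>A module indexed by the subposet \<open>P\<close>, extended by \<open>0\<close> to all of \<open>'p\<close>.\<close>

definition extend_zero ::
  "'p set \<Rightarrow> ('p, 'k, 'v::zero) pmod \<Rightarrow> ('p, 'k, 'v) pmod" where
  "extend_zero P M =
     \<lparr>scl = scl M,
      sp = (\<lambda>a. if a \<in> P then sp M a else {0}),
      imap = (\<lambda>a b v. if a \<in> P \<and> b \<in> P then imap M a b v else 0)\<rparr>"


section \<open>Intervals and barcodes\<close>

definition is_interval_of :: "'p::order set \<Rightarrow> 'p set \<Rightarrow> bool" where
  "is_interval_of P J \<longleftrightarrow>
     J \<noteq> {} \<and> J \<subseteq> P \<and>
     (\<forall>a\<in>J. \<forall>b\<in>P. \<forall>c\<in>J. a \<le> b \<longrightarrow> b \<le> c \<longrightarrow> b \<in> J) \<and>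
     (\<forall>a\<in>J. \<forall>c\<in>J. (\<lambda>x y. x \<in> J \<and> y \<in> J \<and> (x \<le> y \<or> y \<le> x))\<^sup>*\<^sup>* a c)"

definition interval_module :: "'p set \<Rightarrow> ('p, 'k::field, 'k) pmod" where
  "interval_module J =
     \<lparr>scl = (*),
      sp = (\<lambda>a. if a \<in> J then UNIV else {0}),
      imap = (\<lambda>a b v. if a \<in> J \<and> b \<in> J then v else 0)\<rparr>"

text \<open>
  A multiset of subsets of \<open>'p\<close> is represented by a set of pairs \<open>(J, i)\<close>: each pair is one copy of
  \<open>J\<close>, and the label \<open>i\<close> only distinguishes different copies of the same set.  Sub-multisets
  are subsets.  (The finite multisets of the library do not suffice, as barcodes may be infinite.)
\<close>

type_synonym ('p, 'i) barcode = "('p set \<times> 'i) set"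

text \<open>\<open>is_barcode P M B\<close>: the \<open>P\<close>-indexed module \<open>M\<close> is interval decomposable, with barcode \<open>B\<close>.\<close>

definition is_barcode ::
  "'p::order set \<Rightarrow> ('p, 'k::field, 'v::ab_group_add) pmod \<Rightarrow> ('p, 'i) barcode \<Rightarrow> bool" where
  "is_barcode P M B \<longleftrightarrow>
     (\<forall>x\<in>B. is_interval_of P (fst x)) \<and>
     isomorphic P M (direct_sum B (\<lambda>x. interval_module (fst x)))"

text \<open>
  A matching is a partial injective map; its coimage is \<open>dom \<sigma>\<close>, its image is \<open>ran \<sigma>\<close>.
\<close>

definition matching :: "'a set \<Rightarrow> 'b set \<Rightarrow> ('a \<rightharpoonup> 'b) \<Rightarrow> bool" where
  "matching S T \<sigma> \<longleftrightarrow> dom \<sigma> \<subseteq> S \<and> ran \<sigma> \<subseteq> T \<and> inj_on \<sigma> (dom \<sigma>)"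


section \<open>Interleavings\<close>

text \<open>The product order on this type is the order of \<open>R^op x R\<close>.\<close>

type_synonym ropr = "real dual \<times> real"

abbreviation xc :: "ropr \<Rightarrow> real" where "xc p \<equiv> undual (fst p)"
abbreviation yc :: "ropr \<Rightarrow> real" where "yc p \<equiv> snd p"

definition shift_pt :: "real \<Rightarrow> ropr \<Rightarrow> ropr" where
  "shift_pt \<epsilon> p = (dual (xc p - \<epsilon>), yc p + \<epsilon>)"

definition shift :: "real \<Rightarrow> (ropr, 'k, 'v) pmod \<Rightarrow> (ropr, 'k, 'v) pmod" where
  "shift \<epsilon> M =
     \<lparr>scl = scl M,
      sp = (\<lambda>p. sp M (shift_pt \<epsilon> p)),
      imap = (\<lambda>p q. imap M (shift_pt \<epsilon> p) (shift_pt \<epsilon> q))\<rparr>"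

definition shift_morphism :: "real \<Rightarrow> (ropr \<Rightarrow> 'v \<Rightarrow> 'w) \<Rightarrow> ropr \<Rightarrow> 'v \<Rightarrow> 'w" where
  "shift_morphism \<epsilon> f = (\<lambda>p. f (shift_pt \<epsilon> p))"

definition shift_map :: "real \<Rightarrow> (ropr, 'k, 'v) pmod \<Rightarrow> ropr \<Rightarrow> 'v \<Rightarrow> 'v" where
  "shift_map \<epsilon> M = (\<lambda>p. imap M p (shift_pt \<epsilon> p))"

definition interleaved ::
  "real \<Rightarrow> (ropr, 'k::field, 'v::ab_group_add) pmod \<Rightarrow> (ropr, 'k, 'w::ab_group_add) pmod \<Rightarrow> bool"
  where
  "interleaved \<epsilon> M N \<longleftrightarrow>
     (\<exists>f g. morphism UNIV M (shift \<epsilon> N) f \<and> morphism UNIV N (shift \<epsilon> M) g \<and>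
        (\<forall>p. \<forall>v\<in>sp M p. shift_morphism \<epsilon> g p (f p v) = shift_map (2 * \<epsilon>) M p v) \<and>
        (\<forall>p. \<forall>w\<in>sp N p. shift_morphism \<epsilon> f p (g p w) = shift_map (2 * \<epsilon>) N p w))"

definition trivial :: "real \<Rightarrow> (ropr, 'k::field, 'v::ab_group_add) pmod \<Rightarrow> bool" where
  "trivial \<epsilon> M \<longleftrightarrow> (\<forall>p. \<forall>v\<in>sp M p. shift_map \<epsilon> M p v = 0)"

text \<open>For sets, the notions depend on the field, which is passed as a type argument.\<close>

definition interleaved_intervals :: "'k::field itself \<Rightarrow> real \<Rightarrow> ropr set \<Rightarrow> ropr set \<Rightarrow> bool" where
  "interleaved_intervals k \<epsilon> J K \<longleftrightarrow>
     interleaved \<epsilon> (interval_module J :: (ropr, 'k, 'k) pmod) (interval_module K :: (ropr, 'k, 'k) pmod)"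

definition trivial_interval :: "'k::field itself \<Rightarrow> real \<Rightarrow> ropr set \<Rightarrow> bool" where
  "trivial_interval k \<epsilon> J \<longleftrightarrow> trivial \<epsilon> (interval_module J :: (ropr, 'k, 'k) pmod)"

definition nontrivial_part ::
  "'k::field itself \<Rightarrow> real \<Rightarrow> (ropr, 'i) barcode \<Rightarrow> (ropr, 'i) barcode" where
  "nontrivial_part k \<epsilon> B = {x \<in> B. \<not> trivial_interval k \<epsilon> (fst x)}"

definition eps_matching ::
  "'k::field itself \<Rightarrow> real \<Rightarrow> (ropr, 'i) barcode \<Rightarrow> (ropr, 'j) barcode
    \<Rightarrow> (ropr set \<times> 'i \<rightharpoonup> ropr set \<times> 'j) \<Rightarrow> bool" where
  "eps_matching k \<epsilon> C D \<sigma> \<longleftrightarrow>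
     matching C D \<sigma> \<and>
     nontrivial_part k (2 * \<epsilon>) C \<subseteq> dom \<sigma> \<and>
     nontrivial_part k (2 * \<epsilon>) D \<subseteq> ran \<sigma> \<and>
     (\<forall>x y. \<sigma> x = Some y \<longrightarrow> interleaved_intervals k \<epsilon> (fst x) (fst y))"


section \<open>Blocks\<close>

definition U_poset :: "ropr set" where
  "U_poset = {p. xc p \<le> yc p}"

definition BL_oo :: "ereal \<Rightarrow> ereal \<Rightarrow> ropr set" where
  "BL_oo a b = {p \<in> U_poset. a < ereal (xc p) \<and> ereal (yc p) < b}"

definition BL_co :: "real \<Rightarrow> ereal \<Rightarrow> ropr set" where
  "BL_co a b = {p \<in> U_poset. a \<le> yc p \<and> ereal (yc p) < b}"

definition BL_oc :: "ereal \<Rightarrow> real \<Rightarrow> ropr set" where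
  "BL_oc a b = {p \<in> U_poset. a < ereal (xc p) \<and> xc p \<le> b}"

definition BL_cc :: "real \<Rightarrow> real \<Rightarrow> ropr set" where
  "BL_cc a b = {p \<in> U_poset. xc p \<le> b \<and> a \<le> yc p}"

definition is_block :: "ropr set \<Rightarrow> bool" where
  "is_block J \<longleftrightarrow>
     (\<exists>a b. a < b \<and> J = BL_oo a b) \<or>
     (\<exists>a b. ereal a < b \<and> J = BL_co a b) \<or>
     (\<exists>a b. a < ereal b \<and> J = BL_oc a b) \<or>
     (\<exists>a b. J = BL_cc a b)"

datatype block_type = Type_o | Type_co | Type_oc | Type_c

fun has_type :: "block_type \<Rightarrow> ropr set \<Rightarrow> bool" where
  "has_type Type_o J \<longleftrightarrow> (\<exists>a b::real. a < b \<and> J = BL_oo (ereal a) (ereal b))"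
| "has_type Type_co J \<longleftrightarrow>
     (\<exists>a b::real. a < b \<and> J = BL_co a (ereal b)) \<or> (\<exists>b::real. J = BL_oo (-\<infinity>) (ereal b))"
| "has_type Type_oc J \<longleftrightarrow>
     (\<exists>a b::real. a < b \<and> J = BL_oc (ereal a) b) \<or> (\<exists>a::real. J = BL_oo (ereal a) \<infinity>)"
| "has_type Type_c J \<longleftrightarrow>
     (\<exists>a b. J = BL_cc a b) \<or> (\<exists>a. J = BL_co a \<infinity>) \<or> (\<exists>b. J = BL_oc (-\<infinity>) b) \<or>
     J = BL_oo (-\<infinity>) \<infinity>"

definition type_part :: "block_type \<Rightarrow> (ropr, 'i) barcode \<Rightarrow> (ropr, 'i) barcode" where
  "type_part t B = {x \<in> B. has_type t (fst x)}"

text \<open>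
  \<open>is_block_barcode M B\<close>: the module \<open>M\<close>, indexed by \<open>U_poset\<close>, is block decomposable with
  barcode \<open>B\<close>.
\<close>

definition is_block_barcode ::
  "(ropr, 'k::field, 'v::ab_group_add) pmod \<Rightarrow> (ropr, 'i) barcode \<Rightarrow> bool" where
  "is_block_barcode M B \<longleftrightarrow> is_barcode U_poset M B \<and> (\<forall>x\<in>B. is_block (fst x))"

end

theory Submission
  imports Defs
begin

text \<open>
  In the coordinates \<open>s = - x\<close> and \<open>y\<close>, blocks with endpoints of the same kinds differ only
  by two real parameters \<open>w\<close>, \<open>v\<close>, and a nonzero morphism from a block to the
  \<open>\<epsilon>\<close>-shift of another raises each of them by at most \<open>\<epsilon>\<close>.  A morphism never makes
  an endpoint more closed (closed, infinite, open being the order), so all blocks on a chain of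
  two nonzero morphisms whose ends have the same kinds have these kinds too.
  Hence, if such a chain goes from \<open>I\<close> over \<open>J\<close> to \<open>K\<close> with
  \<open>w(I) + v(I) \<le> w(K) + v(K)\<close>, then \<open>J\<close> is \<open>\<epsilon>\<close>-interleaved with \<open>I\<close> or \<open>K\<close>.
  Writing the interleaving morphisms as matrices, for a finite set of blocks of \<open>M\<close> that are not
  \<open>2\<epsilon>\<close>-trivial the product of the two matrices, restricted to the blocks of \<open>N\<close> that are
  \<open>\<epsilon>\<close>-interleaved with one of them, is unitriangular with respect to \<open>w + v\<close>.  This bounds
  the rank and yields Hall's condition.  The marriage theorem, applied in both directions, gives
  a matching that even covers every block that is not \<open>2\<epsilon>\<close>-trivial.
\<close>

section \<open>Matchings\<close>

text \<open>Gaussian elimination by induction on the equations: an unknown \<open>z\<close> that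
  occurs in equation \<open>b\<close> is eliminated from the others. This is the rank bound behind
  Hall's condition for blocks.\<close>

lemma homogeneous_system_nontrivial_solution:
  fixes F :: "'a \<Rightarrow> 'b \<Rightarrow> 'k::field"
  assumes "finite B" "finite A" "card B < card A"
  shows "\<exists>c. (\<exists>x\<in>A. c x \<noteq> 0) \<and> (\<forall>y\<in>B. (\<Sum>x\<in>A. c x * F x y) = 0)"
  using assms
proof (induction B arbitrary: A F rule: finite_induct)
  case empty
  then obtain x where "x \<in> A" by fastforce
  then show ?case by (intro exI[of _ "\<lambda>_. 1"]) auto
next
  case (insert b B)
  show ?case
  proof (cases "\<forall>x\<in>A. F x b = 0")
    case True
    obtain c where c: "\<exists>x\<in>A. c x \<noteq> 0" "\<forall>y\<in>B. (\<Sum>x\<in>A. c x * F x y) = 0"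
      using insert.IH[of A F] insert.prems insert.hyps by auto
    then show ?thesis using True by (intro exI[of _ c]) auto
  next
    case False
    then obtain z where z: "z \<in> A" "F z b \<noteq> 0" by blast
    define F' where "F' x y = F x y - F x b / F z b * F z y" for x y
    have "card B < card (A - {z})" using insert z by simp
    then obtain c where c: "\<exists>x\<in>A - {z}. c x \<noteq> 0"
        "\<forall>y\<in>B. (\<Sum>x\<in>A - {z}. c x * F' x y) = 0"
      using insert.IH[of "A - {z}" F'] insert.prems by auto
    \<comment> \<open>The value of the eliminated unknown is forced by equation
      \<open>b\<close>.\<close>
    define cz where "cz = - (\<Sum>x\<in>A - {z}. c x * F x b) / F z b"
    define c' where "c' = c(z := cz)"
    have expand: "(\<Sum>x\<in>A. c' x * F x y) = (\<Sum>x\<in>A - {z}. c x * F' x y)" for y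
    proof -
      have "(\<Sum>x\<in>A. c' x * F x y) = cz * F z y + (\<Sum>x\<in>A - {z}. c' x * F x y)"
        using insert.prems z by (simp add: sum.remove c'_def)
      also have "(\<Sum>x\<in>A - {z}. c' x * F x y) = (\<Sum>x\<in>A - {z}. c x * F x y)"
        by (rule sum.cong) (auto simp: c'_def)
      also have "cz * F z y = - (\<Sum>x\<in>A - {z}. c x * (F x b / F z b * F z y))"
        by (simp add: cz_def sum_distrib_left sum_divide_distrib mult_ac)
      finally show ?thesis
        by (simp add: F'_def sum_subtractf algebra_simps)
    qed
    have "F' x b = 0" for x using z by (simp add: F'_def)
    then have "\<forall>y\<in>insert b B. (\<Sum>x\<in>A. c' x * F x y) = 0"
      using c(2) by (auto simp: expand)
    moreover have "\<exists>x\<in>A. c' x \<noteq> 0" using c(1) by (auto simp: c'_def)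
    ultimately show ?thesis by blast
  qed
qed

section \<open>Hall's marriage theorem for infinite families of finite sets\<close>

definition hall :: "'a set \<Rightarrow> ('a \<Rightarrow> 'b set) \<Rightarrow> bool" where
  "hall A N \<longleftrightarrow> (\<forall>S\<subseteq>A. finite S \<longrightarrow> card S \<le> card (\<Union> (N ` S)))"

text \<open>
  Rado's proof: a minimal family of sets that still satisfies Hall's condition consists of
  singletons, by submodularity of \<open>S \<mapsto> card (\<Union> (N ` S))\<close>.
\<close>

lemma hall_minimal_singleton:
  assumes fin: "\<And>x. x \<in> A \<Longrightarrow> finite (N x)" and hall: "hall A N" and x: "x \<in> A"
    and minimal: "\<And>y. y \<in> N x \<Longrightarrow> \<not> hall A (N(x := N x - {y}))"
  shows "card (N x) = 1"
proof (rule ccontr)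
  let ?U = "\<lambda>S. \<Union> (N ` S)"
  assume "card (N x) \<noteq> 1"
  moreover have "1 \<le> card (N x)"
    using hall[unfolded hall_def, rule_format, of "{x}"] x by simp
  ultimately obtain y1 y2 where y: "y1 \<in> N x" "y2 \<in> N x" "y1 \<noteq> y2"
    using card_le_Suc0_iff_eq[OF fin[OF x]] by force
  \<comment> \<open>Removing \<open>y\<close> can violate Hall's condition only at a set containing
    \<open>x\<close>; \<open>S\<close> is that set without \<open>x\<close>, so the strict
    inequality becomes a weak one.\<close>
  have obstruction: "\<exists>S\<subseteq>A - {x}. finite S \<and> card (?U S \<union> (N x - {y})) \<le> card S"
    if yN: "y \<in> N x" for y
  proof -
    let ?N = "N(x := N x - {y})"
    obtain S where S: "S \<subseteq> A" "finite S" "card (\<Union> (?N ` S)) < card S"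
      using minimal[OF yN] by (auto simp: hall_def not_le)
    have "x \<in> S"
    proof (rule ccontr)
      assume "x \<notin> S"
      then have "\<Union> (?N ` S) = ?U S" by auto
      then show False using S hall by (auto simp: hall_def not_le[symmetric])
    qed
    moreover have "\<Union> (?N ` S) = ?U (S - {x}) \<union> (N x - {y})"
      using \<open>x \<in> S\<close> by (auto split: if_splits)
    ultimately show ?thesis using S by (intro exI[of _ "S - {x}"]) auto
  qed
  obtain S1 where S1: "S1 \<subseteq> A - {x}" "finite S1" "card (?U S1 \<union> (N x - {y1})) \<le> card S1"
    using obstruction[OF y(1)] by blast
  obtain S2 where S2: "S2 \<subseteq> A - {x}" "finite S2" "card (?U S2 \<union> (N x - {y2})) \<le> card S2"
    using obstruction[OF y(2)] by blast
  let ?V1 = "?U S1 \<union> (N x - {y1})" and ?V2 = "?U S2 \<union> (N x - {y2})"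
  have finU: "finite (?U S)" if "S \<subseteq> A" "finite S" for S using that fin by auto
  have fV: "finite ?V1" "finite ?V2" using S1 S2 fin x finU by auto
  have "card (insert x (S1 \<union> S2)) \<le> card (?U (insert x (S1 \<union> S2)))"
    using hall S1 S2 x unfolding hall_def by (metis Diff_subset Un_least finite_UnI finite_insert insert_subset order_trans)
  \<comment> \<open>Since \<open>y1\<close> and \<open>y2\<close> differ, the two punctured copies
    of \<open>N x\<close> cover \<open>N x\<close>. The bounds for union and intersection add up to
    \<open>card S1 + card S2 + 1\<close> on one side and at most \<open>card S1 + card S2\<close> on
    the other.\<close>
  also have "?U (insert x (S1 \<union> S2)) = ?V1 \<union> ?V2" using y by auto
  finally have 1: "Suc (card (S1 \<union> S2)) \<le> card (?V1 \<union> ?V2)"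
    using S1 S2 by (subst (asm) card_insert_disjoint) auto
  have "card (S1 \<inter> S2) \<le> card (?U (S1 \<inter> S2))"
    using hall[unfolded hall_def, rule_format, of "S1 \<inter> S2"] S1 by auto
  also have "\<dots> \<le> card (?V1 \<inter> ?V2)" using fV by (intro card_mono) auto
  finally have 2: "card (S1 \<inter> S2) \<le> card (?V1 \<inter> ?V2)" .
  show False
    using 1 2 S1 S2 card_Un_Int[OF fV] card_Un_Int[OF S1(2) S2(2)] by linarith
qed

text \<open>Zorn's lemma for the set \<open>R\<close> of removed pairs: a maximal \<open>R\<close>
  leaves a minimal family. Hall's condition survives along a chain because a finite \<open>S\<close>
  involves only finitely many removed pairs, all of which lie in one member of the chain.\<close>

lemma hall_minimal_exists:
  fixes N :: "'a \<Rightarrow> 'b set"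
  assumes fin: "\<And>x. x \<in> A \<Longrightarrow> finite (N x)" and hall: "hall A N"
  obtains N' where "hall A N'" "\<And>x. x \<in> A \<Longrightarrow> N' x \<subseteq> N x"
    "\<And>x y. x \<in> A \<Longrightarrow> y \<in> N' x \<Longrightarrow> \<not> hall A (N'(x := N' x - {y}))"
proof -
  define W where "W R x = N x - R `` {x}" for R x
  define Q where "Q = {R. R \<subseteq> {(x, y). x \<in> A \<and> y \<in> N x} \<and> hall A (W R)}"
  have "\<exists>R\<in>Q. \<forall>R'\<in>Q. R \<subseteq> R' \<longrightarrow> R' = R"
  proof (rule subset_Zorn_nonempty)
    have "W {} = N" by (auto simp: W_def)
    then have "{} \<in> Q" using hall by (auto simp: Q_def)
    then show "Q \<noteq> {}" by blast
  next
    fix C assume C: "C \<noteq> {}" "subset.chain Q C"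
    have "hall A (W (\<Union>C))"
      unfolding hall_def
    proof (intro allI impI)
      fix S assume S: "S \<subseteq> A" "finite S"
      let ?E = "{(x, y). x \<in> S \<and> (x, y) \<in> \<Union>C}"
      have "?E \<subseteq> Sigma S N" using C by (auto simp: subset.chain_def Q_def)
      then have "finite ?E" using S fin by (meson finite_SigmaI finite_subset subsetD)
      moreover have "?E \<subseteq> \<Union>C" by auto
      ultimately obtain R where R: "R \<in> C" "?E \<subseteq> R"
        using C finite_subset_Union_chain[of ?E C Q] by blast
      then have "\<Union> (W (\<Union>C) ` S) = \<Union> (W R ` S)" by (auto simp: W_def)
      moreover have "hall A (W R)" using R C by (auto simp: subset.chain_def Q_def)
      ultimately show "card S \<le> card (\<Union> (W (\<Union>C) ` S))"
        using S by (auto simp: hall_def)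
    qed
    then show "\<Union>C \<in> Q" using C by (auto simp: subset.chain_def Q_def)
  qed
  then obtain R where R: "R \<in> Q" and max: "\<And>R'. R' \<in> Q \<Longrightarrow> R \<subseteq> R' \<Longrightarrow> R' = R" by blast
  show ?thesis
  proof (rule that[of "W R"])
    show "hall A (W R)" using R by (simp add: Q_def)
    show "W R x \<subseteq> N x" for x by (auto simp: W_def)
  next
    fix x y assume xy: "x \<in> A" "y \<in> W R x"
    have eq: "(W R)(x := W R x - {y}) = W (insert (x, y) R)" by (auto simp: W_def fun_eq_iff)
    show "\<not> hall A ((W R)(x := W R x - {y}))"
    proof
      assume "hall A ((W R)(x := W R x - {y}))"
      then have "hall A (W (insert (x, y) R))" unfolding eq .
      then have "insert (x, y) R \<in> Q" using R xy by (auto simp: Q_def W_def[of R x])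
      from max[OF this] show False using xy by (auto simp: W_def)
    qed
  qed
qed

text \<open>A minimal family consists of singletons, which are distinct by Hall's condition for sets
  of two elements.\<close>

theorem hall_infinite:
  fixes N :: "'a \<Rightarrow> 'b set"
  assumes fin: "\<And>x. x \<in> A \<Longrightarrow> finite (N x)" and hall: "hall A N"
  obtains h where "inj_on h A" "\<And>x. x \<in> A \<Longrightarrow> h x \<in> N x"
proof -
  obtain N' where N': "hall A N'" and sub: "\<And>x. x \<in> A \<Longrightarrow> N' x \<subseteq> N x"
    and min: "\<And>x y. x \<in> A \<Longrightarrow> y \<in> N' x \<Longrightarrow> \<not> hall A (N'(x := N' x - {y}))"
    using hall_minimal_exists[OF fin hall] by metis
  have "\<exists>y. N' x = {y}" if "x \<in> A" for x
  proof -
    have "card (N' x) = 1"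
      using sub fin min that N' by (intro hall_minimal_singleton) (auto intro: finite_subset)
    then show ?thesis by (auto simp: card_1_singleton_iff)
  qed
  then obtain h where h: "\<And>x. x \<in> A \<Longrightarrow> N' x = {h x}" by metis
  have "inj_on h A"
  proof (rule inj_onI, rule ccontr)
    fix x y assume xy: "x \<in> A" "y \<in> A" "h x = h y" "x \<noteq> y"
    then have "card {x, y} \<le> card (\<Union> (N' ` {x, y}))"
      using N'[unfolded hall_def, rule_format, of "{x, y}"] by simp
    then show False using xy h by simp
  qed
  then show ?thesis using h sub that by blast
qed

section \<open>Merging injections in both directions into one matching\<close>

text \<open>
  The construction is that of the Schroeder--Bernstein theorem: \<open>X\<close> consists of the points on
  alternating paths that start outside the range of \<open>g\<close>.
\<close>

lemma matching_covering_both: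
  assumes f: "inj_on f A" "\<And>x. x \<in> A \<Longrightarrow> f x \<in> T \<and> R x (f x)"
    and g: "inj_on g B" "\<And>y. y \<in> B \<Longrightarrow> g y \<in> S \<and> R (g y) y"
    and AS: "A \<subseteq> S" and BT: "B \<subseteq> T"
  obtains \<sigma> where "matching S T \<sigma>" "A \<subseteq> dom \<sigma>" "B \<subseteq> ran \<sigma>" "\<And>x y. \<sigma> x = Some y \<Longrightarrow> R x y"
proof -
  define X where "X = lfp (\<lambda>X. (A - g ` B) \<union> (A \<inter> g ` (B \<inter> f ` X)))"
  have X: "X = (A - g ` B) \<union> (A \<inter> g ` (B \<inter> f ` X))"
    unfolding X_def by (rule lfp_unfold) (auto simp: mono_def)
  have XA: "X \<subseteq> A" using X by blast
  let ?Y = "g ` (B - f ` X)"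
  \<comment> \<open>\<open>f\<close> is followed on \<open>X\<close> and \<open>g\<close> is
    reversed elsewhere. By the fixed point equation a point of \<open>A\<close> outside
    \<open>X\<close> lies in \<open>?Y\<close>; a point of \<open>B\<close> is the image under
    \<open>f\<close> of a point of \<open>X\<close> or is reached by reversing
    \<open>g\<close>.\<close>
  define \<sigma> where "\<sigma> x = (if x \<in> X then Some (f x)
      else if x \<in> ?Y then Some (inv_into B g x) else None)" for x
  have inv: "inv_into B g (g y) = y" if "y \<in> B" for y using g that by simp
  have disj: "X \<inter> ?Y = {}" using X g(1) by (blast dest: inj_onD)
  have \<sigma>X: "\<sigma> x = Some (f x)" if "x \<in> X" for x using that by (simp add: \<sigma>_def)
  have \<sigma>Y: "\<sigma> (g y) = Some y" if "y \<in> B - f ` X" for y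
    using that disj inv by (auto simp: \<sigma>_def)
  have cases: "(x \<in> X \<and> y = f x) \<or> (y \<in> B - f ` X \<and> x = g y)" if "\<sigma> x = Some y" for x y
    using that inv by (auto simp: \<sigma>_def split: if_splits)
  show ?thesis
  proof (rule that[of \<sigma>])
    show "matching S T \<sigma>"
      unfolding matching_def
    proof (intro conjI)
      show "dom \<sigma> \<subseteq> S" using cases XA AS g by blast
      show "ran \<sigma> \<subseteq> T" using cases XA BT f by (fastforce simp: ran_def)
      show "inj_on \<sigma> (dom \<sigma>)"
      proof (rule inj_onI)
        fix x x' assume "x \<in> dom \<sigma>" "x' \<in> dom \<sigma>" "\<sigma> x = \<sigma> x'"
        then obtain y where "\<sigma> x = Some y" "\<sigma> x' = Some y" by auto
        then show "x = x'" using cases[of x y] cases[of x' y] XA inj_onD[OF f(1), of x x'] by blast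
      qed
    qed
    show "A \<subseteq> dom \<sigma>"
    proof
      fix x assume "x \<in> A"
      then have "x \<in> X \<or> x \<in> ?Y" using equalityD2[OF X] by blast
      then show "x \<in> dom \<sigma>" using \<sigma>X \<sigma>Y by auto
    qed
    show "B \<subseteq> ran \<sigma>"
    proof
      fix y assume "y \<in> B"
      then show "y \<in> ran \<sigma>" using ranI[of \<sigma>, OF \<sigma>X] ranI[of \<sigma>, OF \<sigma>Y[of y]] by blast
    qed
    show "R x y" if "\<sigma> x = Some y" for x y using cases[OF that] f g XA by blast
  qed
qed

section \<open>Blocks in coordinates\<close>

abbreviation sc :: "ropr \<Rightarrow> real" where "sc p \<equiv> - xc p"

definition pt :: "real \<Rightarrow> real \<Rightarrow> ropr" where "pt s y = (dual (- s), y)"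

lemma sc_pt [simp]: "xc (pt s y) = - s" and yc_pt [simp]: "yc (pt s y) = y"
  by (simp_all add: pt_def)

lemma xc_shift_pt [simp]: "xc (shift_pt \<delta> p) = xc p - \<delta>"
  and yc_shift_pt [simp]: "yc (shift_pt \<delta> p) = yc p + \<delta>"
  by (simp_all add: shift_pt_def)

lemma ropr_le_iff: "p \<le> q \<longleftrightarrow> xc q \<le> xc p \<and> yc p \<le> yc q" for p q :: ropr
  by (simp add: less_eq_prod_def less_eq_dual_def)

lemma shift_pt_shift_pt [simp]: "shift_pt \<delta> (shift_pt \<epsilon> p) = shift_pt (\<epsilon> + \<delta>) p"
  by (simp add: shift_pt_def algebra_simps)

lemma shift_pt_mono: "p \<le> q \<Longrightarrow> shift_pt \<delta> p \<le> shift_pt \<delta> q"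
  by (simp add: ropr_le_iff)

lemma shift_pt_ge: "0 \<le> \<delta> \<Longrightarrow> p \<le> shift_pt \<delta> p"
  by (simp add: ropr_le_iff)

lemma U_poset_up: "p \<in> U_poset \<Longrightarrow> p \<le> q \<Longrightarrow> q \<in> U_poset"
  by (auto simp: U_poset_def ropr_le_iff)

lemma U_poset_shift: "0 \<le> \<delta> \<Longrightarrow> p \<in> U_poset \<Longrightarrow> shift_pt \<delta> p \<in> U_poset"
  by (auto simp: U_poset_def)

text \<open>
  In the coordinates \<open>s = - x\<close> and \<open>y\<close> the order is the product order.  A block is given by
  two endpoints, each of which is closed, infinite, or open: a closed left endpoint \<open>w\<close> bounds
  \<open>y\<close> from below, an open one bounds \<open>s\<close> from above, and the roles of \<open>s\<close> and \<open>y\<close>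
  are exchanged for the right endpoint \<open>v\<close>.  With these signs a shift lowers every finite
  parameter.
\<close>

datatype endpoint_kind = Closed | Unbounded | Open

fun lower_bound :: "endpoint_kind \<Rightarrow> real \<Rightarrow> real \<Rightarrow> bool" where
  "lower_bound Closed w t \<longleftrightarrow> w \<le> t"
| "lower_bound _ w t \<longleftrightarrow> True"

fun upper_bound :: "endpoint_kind \<Rightarrow> real \<Rightarrow> real \<Rightarrow> bool" where
  "upper_bound Open w t \<longleftrightarrow> t < w"
| "upper_bound _ w t \<longleftrightarrow> True"

lemma lower_bound_mono: "lower_bound k w t \<Longrightarrow> t \<le> t' \<Longrightarrow> lower_bound k w t'"
  by (cases k) auto

lemma upper_bound_antimono: "upper_bound k w t' \<Longrightarrow> t \<le> t' \<Longrightarrow> upper_bound k w t"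
  by (cases k) auto

lemma upper_bound_not_open: "k \<noteq> Open \<Longrightarrow> upper_bound k w t"
  by (cases k) auto

text \<open>The inequality \<open>0 \<le> sc p + yc p\<close> is membership in
  \<open>U_poset\<close>. Different parameters of an unbounded endpoint describe the same
  set.\<close>

definition blk :: "endpoint_kind \<Rightarrow> real \<Rightarrow> endpoint_kind \<Rightarrow> real \<Rightarrow> ropr set" where
  "blk k w l v = {p. 0 \<le> sc p + yc p \<and> lower_bound k w (yc p) \<and> upper_bound k w (sc p)
    \<and> lower_bound l v (sc p) \<and> upper_bound l v (yc p)}"

text \<open>An order automorphism that commutes with shifts and exchanges the two endpoints, so that
  statements about the left one carry over to the right one.\<close>

definition swap_pt :: "ropr \<Rightarrow> ropr" where "swap_pt p = pt (yc p) (sc p)"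

lemma swap_pt_simps [simp]:
  "xc (swap_pt p) = - yc p" "yc (swap_pt p) = - xc p" "swap_pt (swap_pt p) = p"
  "swap_pt (shift_pt \<delta> p) = shift_pt \<delta> (swap_pt p)"
  by (simp_all add: swap_pt_def pt_def shift_pt_def)

lemma swap_pt_le_iff: "swap_pt p \<le> swap_pt q \<longleftrightarrow> p \<le> q"
  by (auto simp: ropr_le_iff)

lemma swap_pt_in_blk: "swap_pt p \<in> blk l v k w \<longleftrightarrow> p \<in> blk k w l v"
  by (auto simp: blk_def)

lemma shift_pt_sup: "shift_pt \<delta> (sup p q) = sup (shift_pt \<delta> p) (shift_pt \<delta> q)"
  by (simp add: prod_eq_iff dual_eq_iff shift_pt_def inf_min sup_max min_def max_def)

text \<open>Each coordinate of the join is one of the given ones. Joins later link two points at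
  which a morphism is evaluated.\<close>

lemma blk_sup: "p \<in> blk k w l v \<Longrightarrow> q \<in> blk k w l v \<Longrightarrow> sup p q \<in> blk k w l v"
  by (cases k; cases l) (auto simp: blk_def inf_min sup_max min_def max_def)

lemma blk_convex_shift:
  assumes "p \<in> blk k w l v" "shift_pt \<delta> p \<in> blk k w l v" "0 \<le> \<gamma>" "\<gamma> \<le> \<delta>"
  shows "shift_pt \<gamma> p \<in> blk k w l v"
  using assms by (cases k; cases l) (auto simp: blk_def)

section \<open>Endpoint conditions for a nonzero morphism between blocks\<close>

text \<open>
  The condition under which there is a nonzero morphism from \<open>I\<close> to the \<open>\<epsilon>\<close>-shift of \<open>J\<close>.
\<close>

definition connects :: "real \<Rightarrow> ropr set \<Rightarrow> ropr set \<Rightarrow> bool" where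
  "connects \<epsilon> I J \<longleftrightarrow> (\<exists>p\<in>I. shift_pt \<epsilon> p \<in> J) \<and>
    (\<forall>p\<in>I. \<forall>q\<in>I. p \<le> q \<longrightarrow> shift_pt \<epsilon> q \<in> J \<longrightarrow> shift_pt \<epsilon> p \<in> J) \<and>
    (\<forall>p\<in>I. \<forall>q. p \<le> q \<longrightarrow> shift_pt \<epsilon> p \<in> J \<longrightarrow> shift_pt \<epsilon> q \<in> J \<longrightarrow> q \<in> I)"

lemma connects_up:
  "connects \<epsilon> I J \<Longrightarrow> p \<in> I \<Longrightarrow> shift_pt \<epsilon> p \<in> J \<Longrightarrow> p \<le> q \<Longrightarrow> shift_pt \<epsilon> q \<in> J \<Longrightarrow> q \<in> I"
  unfolding connects_def by blast

lemma connects_down: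
  "connects \<epsilon> I J \<Longrightarrow> p \<in> I \<Longrightarrow> q \<in> I \<Longrightarrow> shift_pt \<epsilon> q \<in> J \<Longrightarrow> p \<le> q \<Longrightarrow> shift_pt \<epsilon> p \<in> J"
  unfolding connects_def by blast

lemma connects_swap:
  assumes "connects \<epsilon> (blk k w l v) (blk k' w' l' v')"
  shows "connects \<epsilon> (blk l v k w) (blk l' v' k' w')"
  unfolding connects_def
proof (intro conjI ballI allI impI)
  obtain p where "p \<in> blk k w l v" "shift_pt \<epsilon> p \<in> blk k' w' l' v'"
    using assms by (auto simp: connects_def)
  then show "\<exists>p\<in>blk l v k w. shift_pt \<epsilon> p \<in> blk l' v' k' w'"
    by (metis swap_pt_in_blk swap_pt_simps(4))
next
  fix p q assume "p \<in> blk l v k w" "q \<in> blk l v k w" "p \<le> q" "shift_pt \<epsilon> q \<in> blk l' v' k' w'"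
  then show "shift_pt \<epsilon> p \<in> blk l' v' k' w'"
    using connects_down[OF assms, of "swap_pt p" "swap_pt q"]
    by (simp add: swap_pt_in_blk swap_pt_le_iff flip: swap_pt_simps(4))
next
  fix p q assume "p \<in> blk l v k w" "p \<le> q" "shift_pt \<epsilon> p \<in> blk l' v' k' w'"
    "shift_pt \<epsilon> q \<in> blk l' v' k' w'"
  then show "q \<in> blk l v k w"
    using connects_up[OF assms, of "swap_pt p" "swap_pt q"]
    by (simp add: swap_pt_in_blk swap_pt_le_iff flip: swap_pt_simps(4))
qed

text \<open>Otherwise, raising the \<open>s\<close> coordinate of a point to \<open>w\<close> leaves
  the source while the shifted point stays in the target, against
  \<open>connects_up\<close>.\<close>

lemma connects_left_open:
  assumes "connects \<epsilon> (blk Open w l v) (blk k' w' l' v')"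
  shows "k' = Open \<and> w' \<le> w + \<epsilon>"
proof (rule ccontr)
  assume neg: "\<not> (k' = Open \<and> w' \<le> w + \<epsilon>)"
  let ?I = "blk Open w l v" and ?J = "blk k' w' l' v'"
  obtain p where p: "p \<in> ?I" "shift_pt \<epsilon> p \<in> ?J" using assms by (auto simp: connects_def)
  define q where "q = pt (max (sc p) w) (yc p)"
  have "p \<le> q" by (auto simp: ropr_le_iff q_def)
  moreover have "shift_pt \<epsilon> q \<in> ?J"
    using p neg by (cases k'; cases l') (auto simp: blk_def q_def max_def split: if_splits)
  ultimately have "q \<in> ?I" using connects_up[OF assms p] by blast
  then show False by (auto simp: blk_def q_def)
qed

lemma connects_right_open:
  assumes "connects \<epsilon> (blk k w Open v) (blk k' w' l' v')"
  shows "l' = Open \<and> v' \<le> v + \<epsilon>"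
  using connects_left_open[OF connects_swap[OF assms]] .

text \<open>A point of the source is lowered in \<open>y\<close>; by \<open>connects_down\<close>
  its shift must not leave the target, which bounds \<open>w'\<close>.\<close>

lemma connects_left_closed:
  assumes "connects \<epsilon> (blk k w l v) (blk Closed w' l' v')"
  shows "k = Closed \<and> w' \<le> w + \<epsilon>"
proof -
  let ?I = "blk k w l v" and ?J = "blk Closed w' l' v'"
  obtain p where p: "p \<in> ?I" "shift_pt \<epsilon> p \<in> ?J" using assms by (auto simp: connects_def)
  have k: "k \<noteq> Open" using connects_left_open assms by blast
  \<comment> \<open>A closed source allows \<open>w\<close> as the lowest value; an unbounded one
    would allow a value whose shift is below \<open>w'\<close>, which is absurd. Raising
    \<open>s\<close> keeps the point in \<open>U_poset\<close> and is harmless since neither left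
    endpoint is open.\<close>
  define y where "y = min (yc p) (if k = Closed then w else w' - \<epsilon> - 1)"
  define s where "s = max (sc p) (- y)"
  have ys: "y \<le> yc p" "sc p \<le> s" "0 \<le> s + y" by (auto simp: y_def s_def)
  then have le: "pt s y \<le> pt s (yc p)" by (simp add: ropr_le_iff)
  have bounds: "lower_bound k w y" "\<And>t. upper_bound k w t" "lower_bound l v s"
    "upper_bound l v y" "lower_bound l' v' (s + \<epsilon>)"
    using p k ys
    by (auto simp: blk_def y_def upper_bound_not_open intro: lower_bound_mono upper_bound_antimono)
      (cases k; simp)
  have 1: "pt s (yc p) \<in> ?I" "pt s y \<in> ?I" "shift_pt \<epsilon> (pt s (yc p)) \<in> ?J"
    using p ys bounds by (auto simp: blk_def add.commute)
  then have "shift_pt \<epsilon> (pt s y) \<in> ?J" using connects_down[OF assms _ _ _ le] by blast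
  then show ?thesis using p(1) by (cases k) (auto simp: blk_def y_def)
qed

lemma connects_right_closed:
  assumes "connects \<epsilon> (blk k w l v) (blk k' w' Closed v')"
  shows "l = Closed \<and> v' \<le> v + \<epsilon>"
  using connects_left_closed[OF connects_swap[OF assms]] .

lemma connects_params:
  assumes "connects \<epsilon> (blk k w l v) (blk k w' l v')"
  shows "(k \<noteq> Unbounded \<longrightarrow> w' \<le> w + \<epsilon>) \<and> (l \<noteq> Unbounded \<longrightarrow> v' \<le> v + \<epsilon>)"
  using connects_left_open[of \<epsilon> w l v k w' l v'] connects_left_closed[of \<epsilon> k w l v w' l v']
    connects_right_open[of \<epsilon> k w v k w' l v'] connects_right_closed[of \<epsilon> k w l v k w' v'] assms
  by (cases k; cases l) auto

text \<open>Openness passes from source to target and closedness from target to source, so with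
  equal outer kinds each holds at all three blocks or at none.\<close>

lemma connects_trans_kinds:
  assumes "connects \<epsilon> (blk k w l v) (blk k' w' l' v')"
    and "connects \<epsilon> (blk k' w' l' v') (blk k w'' l v'')"
  shows "k' = k \<and> l' = l"
proof -
  have "k = Open \<longleftrightarrow> k' = Open" "k = Closed \<longleftrightarrow> k' = Closed"
    using assms connects_left_open connects_left_closed by blast+
  moreover have "l = Open \<longleftrightarrow> l' = Open" "l = Closed \<longleftrightarrow> l' = Closed"
    using assms connects_right_open connects_right_closed by blast+
  ultimately show ?thesis by (cases k; cases l; cases k'; cases l') auto
qed

text \<open>The lower bounds of the middle block follow from those of the first, its upper bounds
  from those of the last.\<close>

lemma blk_between:
  assumes "p \<in> blk k w l v" "shift_pt (2 * \<epsilon>) p \<in> blk k w'' l v''" "0 \<le> \<epsilon>"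
    and "k \<noteq> Unbounded \<longrightarrow> w' \<le> w + \<epsilon> \<and> w'' \<le> w' + \<epsilon>"
    and "l \<noteq> Unbounded \<longrightarrow> v' \<le> v + \<epsilon> \<and> v'' \<le> v' + \<epsilon>"
  shows "shift_pt \<epsilon> p \<in> blk k w' l v'"
  using assms by (cases k; cases l) (auto simp: blk_def)

text \<open>
  For one closed and one open endpoint the two conditions compete, and it is here that the
  comparison of the sums \<open>w + v\<close> is needed.
\<close>

lemma blk_shift_meets:
  assumes "p \<in> blk k w l v" "shift_pt (2 * \<epsilon>) p \<in> blk k w l v"
    and "q \<in> blk k w' l v'" "shift_pt (2 * \<epsilon>) q \<in> blk k w' l v'"
    and "0 \<le> \<epsilon>" "w' \<le> w + 2 * \<epsilon>" "v' \<le> v + 2 * \<epsilon>" "w + v \<le> w' + v'"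
  obtains r where "r \<in> blk k w l v" "shift_pt (2 * \<epsilon>) r \<in> blk k w' l v'"
proof -
  \<comment> \<open>The lower bounds of the first block and the upper bounds of the second one,
    shifted back, suffice; the others follow from the bounds on \<open>w'\<close> and
    \<open>v'\<close>.\<close>
  have "\<exists>s y. 0 \<le> s + y \<and> lower_bound k w y \<and> upper_bound k (w' - 2 * \<epsilon>) s
    \<and> lower_bound l v s \<and> upper_bound l (v' - 2 * \<epsilon>) y"
  proof (cases "k = Open")
    case kO: True
    show ?thesis
    proof (cases "l = Open")
      case True
      then show ?thesis
        using kO assms(3,4) by - (rule exI[of _ "sc q"], rule exI[of _ "yc q"], auto simp: blk_def)
    next
      case False
      \<comment> \<open>In the closed case \<open>v < w' - 2 * \<epsilon>\<close> is needed. The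
        points \<open>p\<close> and \<open>q\<close> give \<open>v + 2 * \<epsilon> < w\<close> and
        \<open>v' + 2 * \<epsilon> < w'\<close>, so the comparison of sums yields
        \<open>2 * v + 2 * \<epsilon> < w' + v' < 2 * w' - 2 * \<epsilon>\<close>. The choice of
        \<open>y\<close> below is symmetric.\<close>
      define s where "s = (if l = Closed then v else w' - 2 * \<epsilon> - 1)"
      have "upper_bound k (w' - 2 * \<epsilon>) s" "lower_bound l v s"
        using kO False assms by (cases l; auto simp: blk_def s_def)+
      then show ?thesis
        using kO False by - (rule exI[of _ s], rule exI[of _ "- s"], simp add: upper_bound_not_open)
    qed
  next
    case kO: False
    define y where "y = (if k = Closed then w else if l = Open then v' - 2 * \<epsilon> - 1 else 0)"
    have "lower_bound k w y" "upper_bound l (v' - 2 * \<epsilon>) y"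
      using kO assms by (cases k; cases l; auto simp: blk_def y_def)+
    moreover have "lower_bound l v (max v (- y))" by (cases l) auto
    ultimately show ?thesis
      using kO by - (rule exI[of _ "max v (- y)"], rule exI[of _ y], simp add: upper_bound_not_open)
  qed
  then obtain s y where sy: "0 \<le> s + y" "lower_bound k w y" "upper_bound k (w' - 2 * \<epsilon>) s"
    "lower_bound l v s" "upper_bound l (v' - 2 * \<epsilon>) y" by blast
  have "upper_bound k w s" "upper_bound k w' (s + 2 * \<epsilon>)" "lower_bound k w' (y + 2 * \<epsilon>)"
    using sy assms(6) by (cases k; simp)+
  moreover have "upper_bound l v y" "upper_bound l v' (y + 2 * \<epsilon>)" "lower_bound l v' (s + 2 * \<epsilon>)"
    using sy assms(7) by (cases l; simp)+
  ultimately show ?thesis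
    using sy assms(5) by (intro that[of "pt s y"]) (auto simp: blk_def add.commute)
qed

section \<open>Interleavings of blocks with nearby endpoints\<close>

definition close_blocks :: "real \<Rightarrow> ropr set \<Rightarrow> ropr set \<Rightarrow> bool" where
  "close_blocks \<epsilon> I J \<longleftrightarrow> (\<exists>k w l v w' v'. I = blk k w l v \<and> J = blk k w' l v'
     \<and> \<bar>w - w'\<bar> \<le> \<epsilon> \<and> \<bar>v - v'\<bar> \<le> \<epsilon>)"

lemma close_blocks_sym: "close_blocks \<epsilon> I J \<Longrightarrow> close_blocks \<epsilon> J I"
  unfolding close_blocks_def by (metis abs_minus_commute)

lemma close_blocks_mono: "close_blocks \<epsilon> I J \<Longrightarrow> \<epsilon> \<le> \<delta> \<Longrightarrow> close_blocks \<delta> I J"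
  unfolding close_blocks_def by (blast intro: order_trans)

lemma close_blocks_between:
  assumes "close_blocks \<epsilon> I J" "p \<in> I" "shift_pt (2 * \<epsilon>) p \<in> I"
  shows "shift_pt \<epsilon> p \<in> J"
proof -
  obtain k w l v w' v' where *: "I = blk k w l v" "J = blk k w' l v'"
    "\<bar>w - w'\<bar> \<le> \<epsilon>" "\<bar>v - v'\<bar> \<le> \<epsilon>"
    using assms(1) by (auto simp: close_blocks_def)
  then have "0 \<le> \<epsilon>" "w' \<le> w + \<epsilon>" "w \<le> w' + \<epsilon>" "v' \<le> v + \<epsilon>" "v \<le> v' + \<epsilon>"
    by linarith+
  then show ?thesis using assms(2,3) *(1,2) blk_between[of p k w l v \<epsilon> w v w' v'] by simp
qed

definition interval_map :: "real \<Rightarrow> ropr set \<Rightarrow> ropr set \<Rightarrow> ropr \<Rightarrow> 'k::field \<Rightarrow> 'k" where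
  "interval_map \<epsilon> I J p v = (if p \<in> I \<and> shift_pt \<epsilon> p \<in> J then v else 0)"

lemma close_blocks_morphism:
  assumes "close_blocks \<epsilon> I J"
  shows "morphism UNIV (interval_module I :: (ropr, 'k::field, 'k) pmod)
    (shift \<epsilon> (interval_module J)) (interval_map \<epsilon> I J)"
proof -
  obtain k w l v w' v' where *: "I = blk k w l v" "J = blk k w' l v'"
    "\<bar>w - w'\<bar> \<le> \<epsilon>" "\<bar>v - v'\<bar> \<le> \<epsilon>"
    using assms by (auto simp: close_blocks_def)
  \<comment> \<open>\<open>down\<close> and \<open>up\<close> are the closure conditions of
    \<open>connects\<close>; with them both sides of the naturality square vanish at the same
    time.\<close>
  have down: "shift_pt \<epsilon> p \<in> J" if "p \<in> I" "q \<in> I" "p \<le> q" "shift_pt \<epsilon> q \<in> J" for p q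
    using that * by (cases k; cases l) (auto simp: blk_def ropr_le_iff)
  have up: "q \<in> I" if "p \<in> I" "p \<le> q" "shift_pt \<epsilon> p \<in> J" "shift_pt \<epsilon> q \<in> J" for p q
    using that * by (cases k; cases l) (auto simp: blk_def ropr_le_iff)
  have natural: "interval_map \<epsilon> I J q (imap (interval_module I) p q v)
      = imap (shift \<epsilon> (interval_module J)) p q (interval_map \<epsilon> I J p v)"
    if "p \<le> q" "v \<in> sp (interval_module I) p" for p q and v :: 'k
    using that down[of p q] up[of p q]
    by (simp add: interval_module_def shift_def interval_map_def split: if_splits)
  show ?thesis
    unfolding morphism_def
  proof (intro conjI ballI impI)
    fix p
    show "linear_between (scl (interval_module I)) (sp (interval_module I) p)
        (scl (shift \<epsilon> (interval_module J))) (sp (shift \<epsilon> (interval_module J)) p)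
        (interval_map \<epsilon> I J p :: 'k \<Rightarrow> 'k)"
      by (simp add: linear_between_def interval_module_def shift_def interval_map_def)
  qed (rule natural)
qed

lemma close_blocks_interval_map_comp:
  assumes "close_blocks \<epsilon> I J" "p \<notin> I \<longrightarrow> v = 0"
  shows "interval_map \<epsilon> J I (shift_pt \<epsilon> p) (interval_map \<epsilon> I J p v)
    = shift_map (2 * \<epsilon>) (interval_module I) p v"
proof (cases "p \<in> I \<and> shift_pt (2 * \<epsilon>) p \<in> I")
  case True
  then have "shift_pt \<epsilon> p \<in> J" using close_blocks_between[OF assms(1)] by blast
  then show ?thesis
    using True by (simp add: interval_map_def shift_map_def interval_module_def flip: mult_2)
next
  case False
  then show ?thesis
    using assms(2) by (simp add: interval_map_def shift_map_def interval_module_def flip: mult_2)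
qed

lemma close_blocks_interleaved:
  assumes "close_blocks \<epsilon> I J"
  shows "interleaved_intervals TYPE('k::field) \<epsilon> I J"
  unfolding interleaved_intervals_def interleaved_def
proof (intro exI conjI allI ballI)
  have sp: "p \<notin> K \<longrightarrow> v = 0" if "v \<in> sp (interval_module K) p" for v :: 'k and p :: ropr and K
    using that by (auto simp: interval_module_def)
  show "morphism UNIV (interval_module I :: (ropr, 'k, 'k) pmod)
    (shift \<epsilon> (interval_module J)) (interval_map \<epsilon> I J)"
    using assms by (rule close_blocks_morphism)
  show "morphism UNIV (interval_module J :: (ropr, 'k, 'k) pmod)
    (shift \<epsilon> (interval_module I)) (interval_map \<epsilon> J I)"
    using assms[THEN close_blocks_sym] by (rule close_blocks_morphism)
  show "shift_morphism \<epsilon> (interval_map \<epsilon> J I) p (interval_map \<epsilon> I J p v)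
      = shift_map (2 * \<epsilon>) (interval_module I) p v"
    if "v \<in> sp (interval_module I) p" for p and v :: 'k
    using close_blocks_interval_map_comp[OF assms] sp[OF that] by (simp add: shift_morphism_def)
  show "shift_morphism \<epsilon> (interval_map \<epsilon> I J) p (interval_map \<epsilon> J I p v)
      = shift_map (2 * \<epsilon>) (interval_module J) p v"
    if "v \<in> sp (interval_module J) p" for p and v :: 'k
    using close_blocks_interval_map_comp[OF assms[THEN close_blocks_sym]] sp[OF that]
    by (simp add: shift_morphism_def)
qed

section \<open>Triviality and types of blocks\<close>

lemma trivial_interval_iff:
  "trivial_interval TYPE('k::field) \<delta> J \<longleftrightarrow> (\<forall>p\<in>J. shift_pt \<delta> p \<notin> J)"
proof -
  have "(\<forall>v\<in>sp (interval_module J) p. shift_map \<delta> (interval_module J) p v = (0::'k))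
      \<longleftrightarrow> (p \<in> J \<longrightarrow> shift_pt \<delta> p \<notin> J)" for p
    by (cases "p \<in> J \<and> shift_pt \<delta> p \<in> J")
      (auto simp: shift_map_def interval_module_def intro!: exI[of _ 1])
  then show ?thesis by (auto simp: trivial_interval_def trivial_def)
qed

lemma blk_nontrivial_mono:
  assumes "\<not> trivial_interval TYPE('k::field) \<delta> (blk k w l v)" "0 \<le> \<gamma>" "\<gamma> \<le> \<delta>"
  shows "\<not> trivial_interval TYPE('k) \<gamma> (blk k w l v)"
  using assms blk_convex_shift unfolding trivial_interval_iff by blast

lemma type_c_shift_closed:
  assumes "has_type Type_c J" "p \<in> J" "0 \<le> \<delta>"
  shows "shift_pt \<delta> p \<in> J"
  using assms by (auto simp: BL_oo_def BL_oc_def BL_co_def BL_cc_def U_poset_def)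

text \<open>With the parameter of an unbounded endpoint set to 0, estimates on parameters hold at
  such endpoints as well.\<close>

definition represents :: "ropr set \<Rightarrow> endpoint_kind \<Rightarrow> real \<Rightarrow> endpoint_kind \<Rightarrow> real \<Rightarrow> bool" where
  "represents J k w l v \<longleftrightarrow> J = blk k w l v \<and> (k = Unbounded \<longrightarrow> w = 0) \<and> (l = Unbounded \<longrightarrow> v = 0)"

lemma BL_eq_blk:
  "BL_oo (ereal a) (ereal b) = blk Open (- a) Open b"
  "BL_oo (ereal a) \<infinity> = blk Open (- a) Unbounded 0"
  "BL_oo (- \<infinity>) (ereal b) = blk Unbounded 0 Open b"
  "BL_oo (- \<infinity>) \<infinity> = blk Unbounded 0 Unbounded 0"
  "BL_co a (ereal b) = blk Closed a Open b"
  "BL_co a \<infinity> = blk Closed a Unbounded 0"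
  "BL_oc (ereal a) b = blk Open (- a) Closed (- b)"
  "BL_oc (- \<infinity>) b = blk Unbounded 0 Closed (- b)"
  "BL_cc a b = blk Closed a Closed (- b)"
  by (auto simp: BL_oo_def BL_oc_def BL_co_def BL_cc_def U_poset_def blk_def)

lemma block_represented:
  assumes "is_block J"
  shows "\<exists>k w l v. represents J k w l v"
proof -
  consider a b where "a < b" "J = BL_oo a b" | a b where "ereal a < b" "J = BL_co a b"
    | a b where "a < ereal b" "J = BL_oc a b" | a b where "J = BL_cc a b"
    using assms by (auto simp: is_block_def)
  then show ?thesis
  proof cases
    case 1
    then show ?thesis by (cases a; cases b) (auto simp: BL_eq_blk represents_def)
  next
    case 2
    then show ?thesis by (cases b) (auto simp: BL_eq_blk represents_def)
  next
    case 3
    then show ?thesis by (cases a) (auto simp: BL_eq_blk represents_def)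
  next
    case 4
    then show ?thesis by (auto simp: BL_eq_blk represents_def)
  qed
qed

text \<open>An infinite endpoint counts as closed, in accordance with
  \<open>has_type\<close>.\<close>

fun block_type_of :: "endpoint_kind \<Rightarrow> endpoint_kind \<Rightarrow> block_type" where
  "block_type_of Open Open = Type_o"
| "block_type_of Open _ = Type_oc"
| "block_type_of _ Open = Type_co"
| "block_type_of _ _ = Type_c"

lemma has_type_BL:
  fixes a b :: real
  shows "a < b \<Longrightarrow> has_type Type_o (BL_oo (ereal a) (ereal b))"
    and "a < b \<Longrightarrow> has_type Type_co (BL_co a (ereal b))"
    and "has_type Type_co (BL_oo (- \<infinity>) (ereal b))"
    and "a < b \<Longrightarrow> has_type Type_oc (BL_oc (ereal a) b)"
    and "has_type Type_oc (BL_oo (ereal a) \<infinity>)"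
    and "has_type Type_c (BL_cc a b)"
    and "has_type Type_c (BL_co a \<infinity>)"
    and "has_type Type_c (BL_oc (- \<infinity>) b)"
    and "has_type Type_c (BL_oo (- \<infinity>) \<infinity>)"
  unfolding has_type.simps by blast+

lemma represents_has_type:
  assumes rep: "represents J k w l v" and "J \<noteq> {}"
  shows "has_type (block_type_of k l) J"
proof -
  obtain p where "p \<in> blk k w l v" using assms by (auto simp: represents_def)
  \<comment> \<open>For two finite endpoints, not both closed, the type demands
    \<open>a < b\<close>; a point of the block provides it.\<close>
  then have ineq: "k = Open \<Longrightarrow> l = Open \<Longrightarrow> - w < v" "k = Closed \<Longrightarrow> l = Open \<Longrightarrow> w < v"
    "k = Open \<Longrightarrow> l = Closed \<Longrightarrow> - w < - v"
    by (auto simp: blk_def)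
  have blk_eq: "blk Open w Open v = BL_oo (ereal (- w)) (ereal v)"
    "blk Open w Unbounded 0 = BL_oo (ereal (- w)) \<infinity>"
    "blk Open w Closed v = BL_oc (ereal (- w)) (- v)"
    "blk Unbounded 0 Closed v = BL_oc (- \<infinity>) (- v)"
    "blk Closed w Closed v = BL_cc w (- v)"
    by (simp_all add: BL_eq_blk)
  show ?thesis
    using rep ineq
    by (cases k; cases l)
      (simp_all add: represents_def blk_eq BL_eq_blk(3-6)[symmetric] has_type_BL
        del: has_type.simps uminus_ereal.simps)
qed

section \<open>Interleavings as matrices\<close>

declare split_paired_All [simp del] split_paired_Ex [simp del]

section \<open>Transfer of an interleaving to direct sums of interval modules\<close>

abbreviation bsum :: "(ropr, 'i) barcode \<Rightarrow> (ropr, 'k::field, ropr set \<times> 'i \<Rightarrow> 'k) pmod" where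
  "bsum B \<equiv> direct_sum B (\<lambda>x. interval_module (fst x))"

lemma sp_bsum:
  "u \<in> sp (bsum B) p \<longleftrightarrow> finite {x. u x \<noteq> 0} \<and> (\<forall>x. u x \<noteq> 0 \<longrightarrow> x \<in> B \<and> p \<in> fst x)"
  by (simp add: direct_sum_def interval_module_def) blast

lemma imap_bsum:
  "imap (bsum B) p q u = (\<lambda>x. if x \<in> B \<and> p \<in> fst x \<and> q \<in> fst x then u x else 0)"
  by (auto simp: direct_sum_def interval_module_def)

lemma scl_bsum: "scl (bsum B) c u = (\<lambda>x. c * u x)"
  by (simp add: direct_sum_def interval_module_def)

lemma sp_shift [simp]: "sp (shift \<epsilon> M) p = sp M (shift_pt \<epsilon> p)"
  and imap_shift [simp]: "imap (shift \<epsilon> M) p q = imap M (shift_pt \<epsilon> p) (shift_pt \<epsilon> q)"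
  and scl_shift [simp]: "scl (shift \<epsilon> M) = scl M"
  by (simp_all add: shift_def)

lemma morphism_in: "morphism P M N f \<Longrightarrow> a \<in> P \<Longrightarrow> v \<in> sp M a \<Longrightarrow> f a v \<in> sp N a"
  by (simp add: morphism_def linear_between_def)

lemma morphism_add:
  "morphism P M N f \<Longrightarrow> a \<in> P \<Longrightarrow> v \<in> sp M a \<Longrightarrow> w \<in> sp M a \<Longrightarrow> f a (v + w) = f a v + f a w"
  by (simp add: morphism_def linear_between_def)

lemma morphism_scale:
  "morphism P M N f \<Longrightarrow> a \<in> P \<Longrightarrow> v \<in> sp M a \<Longrightarrow> f a (scl M c v) = scl N c (f a v)"
  by (simp add: morphism_def linear_between_def)

lemma morphism_natural:
  "morphism P M N f \<Longrightarrow> a \<in> P \<Longrightarrow> b \<in> P \<Longrightarrow> a \<le> b \<Longrightarrow> v \<in> sp M a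
    \<Longrightarrow> f b (imap M a b v) = imap N a b (f a v)"
  by (simp add: morphism_def)

lemma morphism_comp:
  assumes f: "morphism P M N f" and g: "morphism P N L g"
  shows "morphism P M L (\<lambda>a v. g a (f a v))"
  unfolding morphism_def linear_between_def
  using morphism_in[OF f] morphism_in[OF g] morphism_add[OF f] morphism_add[OF g]
    morphism_scale[OF f] morphism_scale[OF g] morphism_natural[OF f] morphism_natural[OF g]
  by simp

lemma morphism_shift:
  assumes "0 \<le> \<epsilon>" and f: "morphism U_poset M N f"
  shows "morphism U_poset (shift \<epsilon> M) (shift \<epsilon> N) (shift_morphism \<epsilon> f)"
  unfolding morphism_def linear_between_def
  using U_poset_shift[OF assms(1)] shift_pt_mono[of _ _ \<epsilon>]
    morphism_in[OF f] morphism_add[OF f] morphism_scale[OF f] morphism_natural[OF f]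
  by (simp add: shift_morphism_def)

text \<open>Explicit maps on \<open>U_poset\<close> alone, where the extension by zero disappears:
  for \<open>0 \<le> \<epsilon>\<close> shifts do not leave \<open>U_poset\<close>.\<close>

definition U_interleaving ::
  "real \<Rightarrow> (ropr, 'k::field, 'v::ab_group_add) pmod \<Rightarrow> (ropr, 'k, 'w::ab_group_add) pmod
    \<Rightarrow> (ropr \<Rightarrow> 'v \<Rightarrow> 'w) \<Rightarrow> (ropr \<Rightarrow> 'w \<Rightarrow> 'v) \<Rightarrow> bool" where
  "U_interleaving \<epsilon> M N f g \<longleftrightarrow>
    morphism U_poset M (shift \<epsilon> N) f \<and> morphism U_poset N (shift \<epsilon> M) g \<and>
    (\<forall>p\<in>U_poset. \<forall>v\<in>sp M p. g (shift_pt \<epsilon> p) (f p v) = imap M p (shift_pt (2 * \<epsilon>) p) v) \<and>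
    (\<forall>p\<in>U_poset. \<forall>w\<in>sp N p. f (shift_pt \<epsilon> p) (g p w) = imap N p (shift_pt (2 * \<epsilon>) p) w)"

lemma U_interleaving_sym: "U_interleaving \<epsilon> M N f g \<Longrightarrow> U_interleaving \<epsilon> N M g f"
  by (simp add: U_interleaving_def)

lemma morphism_extend_zero:
  assumes "0 \<le> \<epsilon>"
    and f: "morphism UNIV (extend_zero U_poset M) (shift \<epsilon> (extend_zero U_poset N)) f"
  shows "morphism U_poset M (shift \<epsilon> N) f"
  unfolding morphism_def
proof (intro conjI ballI impI)
  fix p assume "p \<in> U_poset"
  moreover have "linear_between (scl (extend_zero U_poset M)) (sp (extend_zero U_poset M) p)
    (scl (shift \<epsilon> (extend_zero U_poset N))) (sp (shift \<epsilon> (extend_zero U_poset N)) p) (f p)"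
    using f by (simp only: morphism_def UNIV_I simp_thms)
  ultimately show "linear_between (scl M) (sp M p) (scl (shift \<epsilon> N)) (sp (shift \<epsilon> N) p) (f p)"
    using U_poset_shift[OF assms(1)] by (simp add: extend_zero_def)
next
  fix p q v assume "p \<in> U_poset" "q \<in> U_poset" "p \<le> q" "v \<in> sp M p"
  then show "f q (imap M p q v) = imap (shift \<epsilon> N) p q (f p v)"
    using morphism_natural[OF f, of p q v] U_poset_shift[OF assms(1)]
    by (simp add: extend_zero_def)
qed

lemma interleaved_extend_zero:
  assumes "0 \<le> \<epsilon>" and "interleaved \<epsilon> (extend_zero U_poset M) (extend_zero U_poset N)"
  obtains f g where "U_interleaving \<epsilon> M N f g"
proof -
  let ?M = "extend_zero U_poset M" and ?N = "extend_zero U_poset N"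
  obtain f g where f: "morphism UNIV ?M (shift \<epsilon> ?N) f" and g: "morphism UNIV ?N (shift \<epsilon> ?M) g"
    and gf: "\<And>p v. v \<in> sp ?M p \<Longrightarrow> shift_morphism \<epsilon> g p (f p v) = shift_map (2 * \<epsilon>) ?M p v"
    and fg: "\<And>p w. w \<in> sp ?N p \<Longrightarrow> shift_morphism \<epsilon> f p (g p w) = shift_map (2 * \<epsilon>) ?N p w"
    using assms(2) unfolding interleaved_def by blast
  have "2 * \<epsilon> \<ge> 0" using assms(1) by simp
  then have "U_interleaving \<epsilon> M N f g"
    unfolding U_interleaving_def
    using morphism_extend_zero[OF assms(1) f] morphism_extend_zero[OF assms(1) g] gf fg
      U_poset_shift[of "2 * \<epsilon>"]
    by (simp add: extend_zero_def shift_map_def shift_morphism_def)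
  then show ?thesis by (rule that)
qed

lemma U_interleaving_isomorphic:
  assumes "0 \<le> \<epsilon>" and fg: "U_interleaving \<epsilon> M N f g"
    and "isomorphic U_poset M M'" and "isomorphic U_poset N N'"
  obtains f' g' where "U_interleaving \<epsilon> M' N' f' g'"
proof -
  obtain a a' where a: "morphism U_poset M M' a" "morphism U_poset M' M a'"
    "\<And>p v. p \<in> U_poset \<Longrightarrow> v \<in> sp M p \<Longrightarrow> a' p (a p v) = v"
    "\<And>p v. p \<in> U_poset \<Longrightarrow> v \<in> sp M' p \<Longrightarrow> a p (a' p v) = v"
    using assms(3) unfolding isomorphic_def by blast
  obtain b b' where b: "morphism U_poset N N' b" "morphism U_poset N' N b'"
    "\<And>p v. p \<in> U_poset \<Longrightarrow> v \<in> sp N p \<Longrightarrow> b' p (b p v) = v"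
    "\<And>p v. p \<in> U_poset \<Longrightarrow> v \<in> sp N' p \<Longrightarrow> b p (b' p v) = v"
    using assms(4) unfolding isomorphic_def by blast
  have f: "morphism U_poset M (shift \<epsilon> N) f" and g: "morphism U_poset N (shift \<epsilon> M) g"
    using fg by (simp_all add: U_interleaving_def)
  have "U_interleaving \<epsilon> M' N' (\<lambda>p v. b (shift_pt \<epsilon> p) (f p (a' p v)))
      (\<lambda>p v. a (shift_pt \<epsilon> p) (g p (b' p v)))"
    unfolding U_interleaving_def
  proof (intro conjI ballI)
    show "morphism U_poset M' (shift \<epsilon> N') (\<lambda>p v. b (shift_pt \<epsilon> p) (f p (a' p v)))"
      using morphism_comp[OF morphism_comp[OF a(2) f] morphism_shift[OF assms(1) b(1)]]
      by (simp add: shift_morphism_def)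
    show "morphism U_poset N' (shift \<epsilon> M') (\<lambda>p v. a (shift_pt \<epsilon> p) (g p (b' p v)))"
      using morphism_comp[OF morphism_comp[OF b(2) g] morphism_shift[OF assms(1) a(1)]]
      by (simp add: shift_morphism_def)
  next
    fix p v assume p: "p \<in> U_poset" and v: "v \<in> sp M' p"
    have up: "shift_pt \<epsilon> p \<in> U_poset" "shift_pt (2 * \<epsilon>) p \<in> U_poset" "p \<le> shift_pt (2 * \<epsilon>) p"
      using assms(1) p by (simp_all add: U_poset_shift shift_pt_ge)
    have v': "a' p v \<in> sp M p" using morphism_in[OF a(2) p v] .
    have "a (shift_pt (2 * \<epsilon>) p) (g (shift_pt \<epsilon> p) (f p (a' p v)))
        = a (shift_pt (2 * \<epsilon>) p) (imap M p (shift_pt (2 * \<epsilon>) p) (a' p v))"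
      using fg p v' by (simp add: U_interleaving_def)
    also have "\<dots> = imap M' p (shift_pt (2 * \<epsilon>) p) v"
      using morphism_natural[OF a(1) p up(2,3) v'] a(4)[OF p v] by simp
    finally show "a (shift_pt \<epsilon> (shift_pt \<epsilon> p))
        (g (shift_pt \<epsilon> p) (b' (shift_pt \<epsilon> p) (b (shift_pt \<epsilon> p) (f p (a' p v)))))
        = imap M' p (shift_pt (2 * \<epsilon>) p) v"
      using b(3)[OF up(1)] morphism_in[OF f p v'] by (simp flip: mult_2)
  next
    fix p v assume p: "p \<in> U_poset" and v: "v \<in> sp N' p"
    have up: "shift_pt \<epsilon> p \<in> U_poset" "shift_pt (2 * \<epsilon>) p \<in> U_poset" "p \<le> shift_pt (2 * \<epsilon>) p"
      using assms(1) p by (simp_all add: U_poset_shift shift_pt_ge)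
    have v': "b' p v \<in> sp N p" using morphism_in[OF b(2) p v] .
    have "b (shift_pt (2 * \<epsilon>) p) (f (shift_pt \<epsilon> p) (g p (b' p v)))
        = b (shift_pt (2 * \<epsilon>) p) (imap N p (shift_pt (2 * \<epsilon>) p) (b' p v))"
      using fg p v' by (simp add: U_interleaving_def)
    also have "\<dots> = imap N' p (shift_pt (2 * \<epsilon>) p) v"
      using morphism_natural[OF b(1) p up(2,3) v'] b(4)[OF p v] by simp
    finally show "b (shift_pt \<epsilon> (shift_pt \<epsilon> p))
        (f (shift_pt \<epsilon> p) (a' (shift_pt \<epsilon> p) (a (shift_pt \<epsilon> p) (g p (b' p v)))))
        = imap N' p (shift_pt (2 * \<epsilon>) p) v"
      using a(3)[OF up(1)] morphism_in[OF g p v'] by (simp flip: mult_2)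
  qed
  then show ?thesis by (rule that)
qed

section \<open>Matrix entries of morphisms between direct sums\<close>

definition unit_at :: "'a \<Rightarrow> 'a \<Rightarrow> 'k::field" where
  "unit_at x = (\<lambda>y. if y = x then 1 else 0)"

lemma unit_at_in_bsum: "x \<in> B \<Longrightarrow> p \<in> fst x \<Longrightarrow> unit_at x \<in> sp (bsum B) p"
  by (auto simp: sp_bsum unit_at_def)

text \<open>Finitely many generators at \<open>q\<close> have images with finite joint support, and
  so has all they span. The isomorphism reaches the unit vector of every bar through
  \<open>q\<close>, so each such bar is in that support.\<close>

lemma pfd_barcode_finite:
  fixes M :: "(ropr, 'k::field, 'v::ab_group_add) pmod"
  assumes M: "persistence_module U_poset M" "pfd U_poset M"
    and iso: "isomorphic U_poset M (bsum B)" and q: "q \<in> U_poset"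
  shows "finite {y \<in> B. q \<in> fst y}"
proof -
  obtain a a' where a: "morphism U_poset M (bsum B) a" "morphism U_poset (bsum B) M a'"
    "\<And>p v. p \<in> U_poset \<Longrightarrow> v \<in> sp (bsum B) p \<Longrightarrow> a p (a' p v) = v"
    using iso unfolding isomorphic_def by blast
  obtain S where S: "finite S" "module.span (scl M) S = sp M q"
    using M(2) q by (auto simp: pfd_def)
  interpret vector_space "scl M" using M(1) by (simp add: persistence_module_def)
  let ?T = "\<Union>s\<in>S. {x. a q s x \<noteq> 0}"
  have "finite ?T"
    using S morphism_in[OF a(1) q] span_base by (fastforce simp: sp_bsum)
  have supp: "v \<in> sp M q \<and> {x. a q v x \<noteq> 0} \<subseteq> ?T" if "v \<in> span S" for v
    using that
  proof (rule span_induct)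
    have sub: "subspace (sp M q)" using M(1) q by (simp add: persistence_module_def)
    show "subspace {v. v \<in> sp M q \<and> {x. a q v x \<noteq> 0} \<subseteq> ?T}"
    proof (rule subspaceI; clarsimp)
      have "a q (scl M 0 0) = scl (bsum B) 0 (a q 0)"
        using morphism_scale[OF a(1) q subspace_0[OF sub]] .
      then have "a q 0 x = 0" for x by (simp add: scl_bsum)
      then show "0 \<in> sp M q \<and> {x. a q 0 x \<noteq> 0} \<subseteq> ?T" using subspace_0[OF sub] by simp
    next
      fix v w assume v: "v \<in> sp M q" "{x. a q v x \<noteq> 0} \<subseteq> ?T"
        and w: "w \<in> sp M q" "{x. a q w x \<noteq> 0} \<subseteq> ?T"
      then show "v + w \<in> sp M q \<and> {x. a q (v + w) x \<noteq> 0} \<subseteq> ?T"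
        using subspace_add[OF sub v(1) w(1)] morphism_add[OF a(1) q v(1) w(1)]
        by (auto simp: subset_iff) (metis add.right_neutral)
    next
      fix c v assume v: "v \<in> sp M q" "{x. a q v x \<noteq> 0} \<subseteq> ?T"
      then show "scl M c v \<in> sp M q \<and> {x. a q (scl M c v) x \<noteq> 0} \<subseteq> ?T"
        using subspace_scale[OF sub v(1)] morphism_scale[OF a(1) q v(1)] by (auto simp: scl_bsum)
    qed
  next
    show "s \<in> sp M q \<and> {x. a q s x \<noteq> 0} \<subseteq> ?T" if "s \<in> S" for s
      using that S(2) span_base by auto
  qed
  have "{y \<in> B. q \<in> fst y} \<subseteq> ?T"
  proof
    fix y assume "y \<in> {y \<in> B. q \<in> fst y}"
    then have y: "(unit_at y :: _ \<Rightarrow> 'k) \<in> sp (bsum B) q" by (simp add: unit_at_in_bsum)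
    have "{x. a q (a' q (unit_at y)) x \<noteq> 0} \<subseteq> ?T"
      using supp morphism_in[OF a(2) q y] S(2) by blast
    moreover have "a q (a' q (unit_at y)) y \<noteq> 0" using a(3)[OF q y] by (simp add: unit_at_def)
    ultimately show "y \<in> ?T" by blast
  qed
  then show ?thesis using \<open>finite ?T\<close> finite_subset by blast
qed

text \<open>On a pair of blocks a morphism is multiplication by one scalar, so it may be read off at
  an arbitrary admissible point; \<open>coeff_eq\<close> proves independence of the choice.\<close>

definition coeff :: "real \<Rightarrow> (ropr \<Rightarrow> (ropr set \<times> 'i \<Rightarrow> 'k::field) \<Rightarrow> ropr set \<times> 'j \<Rightarrow> 'k)
    \<Rightarrow> ropr set \<times> 'i \<Rightarrow> ropr set \<times> 'j \<Rightarrow> 'k" where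
  "coeff \<epsilon> f x y = (if \<exists>p\<in>fst x. shift_pt \<epsilon> p \<in> fst y
    then f (SOME p. p \<in> fst x \<and> shift_pt \<epsilon> p \<in> fst y) (unit_at x) y else 0)"

locale bsum_morphism =
  fixes \<epsilon> :: real and B :: "(ropr, 'i) barcode" and C :: "(ropr, 'j) barcode"
    and f :: "ropr \<Rightarrow> (ropr set \<times> 'i \<Rightarrow> 'k::field) \<Rightarrow> ropr set \<times> 'j \<Rightarrow> 'k"
  assumes eps: "0 \<le> \<epsilon>"
    and B_blocks: "x \<in> B \<Longrightarrow> \<exists>k w l v. fst x = blk k w l v"
    and C_blocks: "y \<in> C \<Longrightarrow> \<exists>k w l v. fst y = blk k w l v"
    and mor: "morphism U_poset (bsum B) (shift \<epsilon> (bsum C)) f"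
begin

lemma B_sub_U: "x \<in> B \<Longrightarrow> p \<in> fst x \<Longrightarrow> p \<in> U_poset"
  using B_blocks by (fastforce simp: blk_def U_poset_def)

lemma zero_map: "p \<in> U_poset \<Longrightarrow> f p (\<lambda>_. 0) = (\<lambda>_. 0)"
  using morphism_scale[OF mor, of p "\<lambda>_. 0" 0] by (simp add: sp_bsum scl_bsum)

lemma unit_in_target:
  assumes "x \<in> B" "p \<in> fst x" "f p (unit_at x) y \<noteq> 0"
  shows "y \<in> C \<and> shift_pt \<epsilon> p \<in> fst y"
  using morphism_in[OF mor B_sub_U[OF assms(1,2)] unit_at_in_bsum[OF assms(1,2)]] assms(3)
  by (simp add: sp_bsum)

text \<open>Entry \<open>y\<close> of the naturality square for \<open>unit_at x\<close>. The unit
  vector dies when \<open>q\<close> leaves \<open>fst x\<close>; if the shift of \<open>p\<close>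
  misses \<open>fst y\<close>, both sides are 0 by \<open>unit_in_target\<close>.\<close>

lemma unit_natural:
  assumes "x \<in> B" "y \<in> C" "p \<in> fst x" "p \<le> q" "shift_pt \<epsilon> q \<in> fst y"
  shows "(if q \<in> fst x then f q (unit_at x) y else 0) = f p (unit_at x) y"
proof -
  have p: "p \<in> U_poset" using B_sub_U assms by blast
  then have q: "q \<in> U_poset" using U_poset_up assms by blast
  have im: "imap (bsum B) p q (unit_at x) = (if q \<in> fst x then unit_at x else (\<lambda>_. 0))"
    using assms by (auto simp: imap_bsum unit_at_def fun_eq_iff)
  have "f q (imap (bsum B) p q (unit_at x))
      = imap (bsum C) (shift_pt \<epsilon> p) (shift_pt \<epsilon> q) (f p (unit_at x))"
    using morphism_natural[OF mor p q assms(4) unit_at_in_bsum[OF assms(1,3)]] by simp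
  then have "f q (if q \<in> fst x then unit_at x else (\<lambda>_. 0)) y
      = (if shift_pt \<epsilon> p \<in> fst y then f p (unit_at x) y else 0)"
    unfolding im using assms(2,5) by (simp add: imap_bsum)
  then show ?thesis
    using unit_in_target[OF assms(1,3), of y] zero_map[OF q] by (auto split: if_splits)
qed

text \<open>Any two admissible points are compared with their join, which is admissible by
  \<open>blk_sup\<close>.\<close>

lemma coeff_eq:
  assumes "x \<in> B" "y \<in> C" "p \<in> fst x" "shift_pt \<epsilon> p \<in> fst y"
  shows "f p (unit_at x) y = coeff \<epsilon> f x y"
proof -
  define q where "q = (SOME p. p \<in> fst x \<and> shift_pt \<epsilon> p \<in> fst y)"
  have "q \<in> fst x \<and> shift_pt \<epsilon> q \<in> fst y"
    unfolding q_def by (rule someI[of _ p]) (use assms in simp)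
  then have q: "q \<in> fst x" "shift_pt \<epsilon> q \<in> fst y" by auto
  have le: "p \<le> sup p q" "q \<le> sup p q" by simp_all
  have "sup p q \<in> fst x" using B_blocks[OF assms(1)] assms(3) q(1) blk_sup by blast
  moreover have "shift_pt \<epsilon> (sup p q) \<in> fst y"
    using C_blocks[OF assms(2)] assms(4) q(2) blk_sup unfolding shift_pt_sup by blast
  ultimately have "f p (unit_at x) y = f q (unit_at x) y"
    using unit_natural[OF assms(1-3) le(1)] unit_natural[OF assms(1,2) q(1) le(2)] by simp
  also have "\<dots> = coeff \<epsilon> f x y" using q by (auto simp: coeff_def q_def)
  finally show ?thesis .
qed

lemma map_unit:
  assumes "x \<in> B" "p \<in> fst x"
  shows "f p (unit_at x) = (\<lambda>y. if y \<in> C \<and> shift_pt \<epsilon> p \<in> fst y then coeff \<epsilon> f x y else 0)"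
  using unit_in_target[OF assms] coeff_eq[OF assms(1) _ assms(2)] by fastforce

text \<open>\<open>unit_natural\<close> identifies the values at \<open>p\<close> and
  \<open>q\<close>; being nonzero at one end, the value is nonzero at the other, which forces the
  membership there.\<close>

lemma coeff_connects:
  assumes x: "x \<in> B" and y: "y \<in> C" and nz: "coeff \<epsilon> f x y \<noteq> 0"
  shows "connects \<epsilon> (fst x) (fst y)"
  unfolding connects_def
proof (intro conjI ballI allI impI)
  show "\<exists>p\<in>fst x. shift_pt \<epsilon> p \<in> fst y" using nz by (auto simp: coeff_def split: if_splits)
next
  fix p q assume "p \<in> fst x" "q \<in> fst x" "p \<le> q" "shift_pt \<epsilon> q \<in> fst y"
  then have "f p (unit_at x) y \<noteq> 0"
    using unit_natural[OF x y, of p q] coeff_eq[OF x y, of q] nz by simp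
  then show "shift_pt \<epsilon> p \<in> fst y" using unit_in_target[OF x \<open>p \<in> fst x\<close>] by blast
next
  fix p q assume "p \<in> fst x" "p \<le> q" "shift_pt \<epsilon> p \<in> fst y" "shift_pt \<epsilon> q \<in> fst y"
  then show "q \<in> fst x"
    using unit_natural[OF x y, of p q] coeff_eq[OF x y, of p] nz by (auto split: if_splits)
qed

lemma map_combination:
  assumes "finite Y" "Y \<subseteq> {x \<in> B. p \<in> fst x}" "p \<in> U_poset"
  shows "f p (\<lambda>x. if x \<in> Y then c x else 0) y = (\<Sum>x\<in>Y. c x * f p (unit_at x) y)"
  using assms(1,2)
proof (induction Y rule: finite_induct)
  case empty
  then show ?case using zero_map[OF assms(3)] by simp
next
  case (insert x Y)
  let ?u = "\<lambda>x. if x \<in> Y then c x else 0"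
  have x: "unit_at x \<in> sp (bsum B) p" using insert.prems by (simp add: unit_at_in_bsum)
  have "scl (bsum B) (c x) (unit_at x) \<in> sp (bsum B) p"
    using x by (auto simp: sp_bsum scl_bsum intro: finite_subset)
  moreover have "?u \<in> sp (bsum B) p"
    using insert.prems insert.hyps(1) by (auto simp: sp_bsum)
  moreover have "(\<lambda>z. if z \<in> insert x Y then c z else 0) = scl (bsum B) (c x) (unit_at x) + ?u"
    using insert.hyps(2) by (auto simp: scl_bsum unit_at_def fun_eq_iff)
  ultimately have "f p (\<lambda>z. if z \<in> insert x Y then c z else 0)
      = scl (bsum C) (c x) (f p (unit_at x)) + f p ?u"
    using morphism_add[OF mor assms(3)] morphism_scale[OF mor assms(3) x] by simp
  then show ?case using insert by (simp add: scl_bsum)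
qed

end

text \<open>Matrix form of \<open>g\<close> after \<open>f\<close> being the internal map: evaluated
  at \<open>unit_at x\<close> and read at \<open>z\<close>, only blocks containing the middle point
  contribute.\<close>

lemma coeff_product:
  assumes f: "bsum_morphism \<epsilon> B C f" and g: "bsum_morphism \<epsilon> C B g"
    and fg: "U_interleaving \<epsilon> (bsum B) (bsum C) f g"
    and fin: "finite {y \<in> C. shift_pt \<epsilon> p \<in> fst y}"
    and x: "x \<in> B" "p \<in> fst x" and z: "z \<in> B" "shift_pt (2 * \<epsilon>) p \<in> fst z"
  shows "(\<Sum>y | y \<in> C \<and> shift_pt \<epsilon> p \<in> fst y. coeff \<epsilon> f x y * coeff \<epsilon> g y z)
    = (if x = z then 1 else 0)"
proof -
  interpret f: bsum_morphism \<epsilon> B C f by (rule f)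
  interpret g: bsum_morphism \<epsilon> C B g by (rule g)
  let ?Y = "{y \<in> C. shift_pt \<epsilon> p \<in> fst y}"
  have p: "p \<in> U_poset" using f.B_sub_U x by blast
  have "(\<Sum>y\<in>?Y. coeff \<epsilon> f x y * coeff \<epsilon> g y z)
      = (\<Sum>y\<in>?Y. coeff \<epsilon> f x y * g (shift_pt \<epsilon> p) (unit_at y) z)"
    using g.coeff_eq[of _ z "shift_pt \<epsilon> p"] z by (intro sum.cong) (simp_all flip: mult_2)
  also have "\<dots> = g (shift_pt \<epsilon> p) (\<lambda>y. if y \<in> ?Y then coeff \<epsilon> f x y else 0) z"
    using g.map_combination[OF fin] U_poset_shift[OF f.eps p] by simp
  also have "\<dots> = g (shift_pt \<epsilon> p) (f p (unit_at x)) z"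
    using f.map_unit[OF x] by simp
  also have "\<dots> = imap (bsum B) p (shift_pt (2 * \<epsilon>) p) (unit_at x) z"
    using fg p x by (simp add: U_interleaving_def unit_at_in_bsum)
  also have "\<dots> = (if x = z then 1 else 0)"
    using x z by (auto simp: imap_bsum unit_at_def)
  finally show ?thesis by simp
qed

section \<open>Hall's condition from one half of an interleaving\<close>

definition shift_persistent :: "real \<Rightarrow> (ropr, 'i) barcode \<Rightarrow> (ropr, 'i) barcode" where
  "shift_persistent \<delta> D = {x \<in> D. \<exists>p\<in>fst x. shift_pt \<delta> p \<in> fst x}"

text \<open>What remains of one direction of an interleaving after passing to matrices. It is used
  twice with \<open>B\<close> and \<open>C\<close> exchanged; \<open>K\<close>, \<open>L\<close>,
  \<open>W\<close>, \<open>V\<close> depend only on the underlying set, so both uses share one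
  notion of closeness.\<close>

locale half_interleaving =
  fixes \<epsilon> :: real and B :: "(ropr, 'i) barcode" and C :: "(ropr, 'j) barcode"
    and F :: "ropr set \<times> 'i \<Rightarrow> ropr set \<times> 'j \<Rightarrow> 'k::field"
    and G :: "ropr set \<times> 'j \<Rightarrow> ropr set \<times> 'i \<Rightarrow> 'k"
    and K L :: "ropr set \<Rightarrow> endpoint_kind" and W V :: "ropr set \<Rightarrow> real"
  assumes eps: "0 \<le> \<epsilon>"
    and rep_B: "x \<in> B \<Longrightarrow> represents (fst x) (K (fst x)) (W (fst x)) (L (fst x)) (V (fst x))"
    and rep_C: "y \<in> C \<Longrightarrow> represents (fst y) (K (fst y)) (W (fst y)) (L (fst y)) (V (fst y))"
    and fin: "p \<in> U_poset \<Longrightarrow> finite {y \<in> C. p \<in> fst y}"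
    and F_connects: "x \<in> B \<Longrightarrow> y \<in> C \<Longrightarrow> F x y \<noteq> 0 \<Longrightarrow> connects \<epsilon> (fst x) (fst y)"
    and G_connects: "y \<in> C \<Longrightarrow> z \<in> B \<Longrightarrow> G y z \<noteq> 0 \<Longrightarrow> connects \<epsilon> (fst y) (fst z)"
    and FG: "x \<in> B \<Longrightarrow> z \<in> B \<Longrightarrow> p \<in> fst x \<Longrightarrow> shift_pt (2 * \<epsilon>) p \<in> fst z \<Longrightarrow>
      (\<Sum>y | y \<in> C \<and> shift_pt \<epsilon> p \<in> fst y. F x y * G y z) = (if x = z then 1 else 0)"
begin

definition same_kind :: "ropr set \<times> 'a \<Rightarrow> ropr set \<times> 'b \<Rightarrow> bool" where
  "same_kind x y \<longleftrightarrow> K (fst x) = K (fst y) \<and> L (fst x) = L (fst y)"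

definition close :: "ropr set \<times> 'a \<Rightarrow> ropr set \<times> 'b \<Rightarrow> bool" where
  "close x y \<longleftrightarrow> same_kind x y \<and> \<bar>W (fst x) - W (fst y)\<bar> \<le> \<epsilon> \<and> \<bar>V (fst x) - V (fst y)\<bar> \<le> \<epsilon>"

abbreviation significant :: "(ropr, 'i) barcode" where
  "significant \<equiv> shift_persistent (2 * \<epsilon>) B"

lemma close_sym: "close x y \<Longrightarrow> close y x"
  by (simp add: close_def same_kind_def abs_minus_commute)

definition neighbours :: "ropr set \<times> 'i \<Rightarrow> (ropr, 'j) barcode" where
  "neighbours x = {y \<in> C. close x y}"

lemma significantE:
  assumes "x \<in> significant"
  obtains p where "x \<in> B" "p \<in> fst x" "shift_pt (2 * \<epsilon>) p \<in> fst x"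
  using assms by (auto simp: shift_persistent_def)

lemma blk_B: "x \<in> B \<Longrightarrow> fst x = blk (K (fst x)) (W (fst x)) (L (fst x)) (V (fst x))"
  using rep_B by (simp add: represents_def)

lemma blk_C: "y \<in> C \<Longrightarrow> fst y = blk (K (fst y)) (W (fst y)) (L (fst y)) (V (fst y))"
  using rep_C by (simp add: represents_def)

lemma close_close_blocks:
  assumes "x \<in> B" "y \<in> C" "close x y"
  shows "close_blocks \<epsilon> (fst x) (fst y)"
  using blk_B[OF assms(1)] blk_C[OF assms(2)] assms(3)
  unfolding close_blocks_def close_def same_kind_def by metis

text \<open>Every neighbour contains the point halfway between \<open>p\<close> and its shift by
  \<open>2 * \<epsilon>\<close>.\<close>

lemma finite_neighbours:
  assumes "x \<in> significant"
  shows "finite (neighbours x)"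
proof -
  obtain p where p: "x \<in> B" "p \<in> fst x" "shift_pt (2 * \<epsilon>) p \<in> fst x"
    using significantE[OF assms] .
  have "neighbours x \<subseteq> {y \<in> C. shift_pt \<epsilon> p \<in> fst y}"
    using close_blocks_between[OF close_close_blocks[OF p(1)] p(2,3)]
    by (auto simp: neighbours_def)
  moreover have "p \<in> U_poset" using blk_B[OF p(1)] p(2) by (auto simp: blk_def U_poset_def)
  then have "shift_pt \<epsilon> p \<in> U_poset" using U_poset_shift eps by blast
  ultimately show ?thesis using fin finite_subset by blast
qed

lemma chain_params:
  assumes x: "x \<in> B" and y: "y \<in> C" and z: "z \<in> B" and F: "F x y \<noteq> 0" and G: "G y z \<noteq> 0"
    and kind: "same_kind x z"
  shows "same_kind x y" "W (fst y) \<le> W (fst x) + \<epsilon>" "V (fst y) \<le> V (fst x) + \<epsilon>"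
    "W (fst z) \<le> W (fst y) + \<epsilon>" "V (fst z) \<le> V (fst y) + \<epsilon>"
proof -
  let ?k = "K (fst x)" and ?l = "L (fst x)"
  have 1: "connects \<epsilon> (blk ?k (W (fst x)) ?l (V (fst x)))
      (blk (K (fst y)) (W (fst y)) (L (fst y)) (V (fst y)))"
    using F_connects[OF x y F] blk_B[OF x] blk_C[OF y] by simp
  have 2: "connects \<epsilon> (blk (K (fst y)) (W (fst y)) (L (fst y)) (V (fst y)))
      (blk ?k (W (fst z)) ?l (V (fst z)))"
    using G_connects[OF y z G] blk_B[OF z] blk_C[OF y] kind by (simp add: same_kind_def)
  have k: "K (fst y) = ?k" "L (fst y) = ?l" using connects_trans_kinds[OF 1 2] by auto
  then show "same_kind x y" by (simp add: same_kind_def)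
  \<comment> \<open>\<open>connects_params\<close> does not bound the parameters of unbounded
    endpoints, but these are all 0.\<close>
  have unbounded: "?k = Unbounded \<Longrightarrow> W (fst x) = 0 \<and> W (fst y) = 0 \<and> W (fst z) = 0"
    "?l = Unbounded \<Longrightarrow> V (fst x) = 0 \<and> V (fst y) = 0 \<and> V (fst z) = 0"
    using rep_B[OF x] rep_C[OF y] rep_B[OF z] k kind by (auto simp: represents_def same_kind_def)
  show "W (fst y) \<le> W (fst x) + \<epsilon>" "V (fst y) \<le> V (fst x) + \<epsilon>"
    using connects_params[OF 1[unfolded k]] unbounded eps by fastforce+
  show "W (fst z) \<le> W (fst y) + \<epsilon>" "V (fst z) \<le> V (fst y) + \<epsilon>"
    using connects_params[OF 2[unfolded k]] unbounded eps by fastforce+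
qed

definition weight :: "ropr set \<times> 'i \<Rightarrow> real" where
  "weight x = W (fst x) + V (fst x)"

text \<open>
  If \<open>y\<close> is close neither to \<open>x\<close> nor to \<open>z\<close>, then both maps of the chain lower the weight,
  since each of them can raise either parameter by at most \<open>\<epsilon>\<close>.
\<close>

lemma chain_close:
  assumes "x \<in> B" "y \<in> C" "z \<in> B" "F x y \<noteq> 0" "G y z \<noteq> 0" "same_kind x z"
    and "weight x \<le> weight z"
  shows "close x y \<or> close z y"
proof -
  note params = chain_params[OF assms(1-6)]
  have "same_kind z y" using params(1) assms(6) by (simp add: same_kind_def)
  moreover have "(\<bar>W (fst x) - W (fst y)\<bar> \<le> \<epsilon> \<and> \<bar>V (fst x) - V (fst y)\<bar> \<le> \<epsilon>) \<or>
      (\<bar>W (fst z) - W (fst y)\<bar> \<le> \<epsilon> \<and> \<bar>V (fst z) - V (fst y)\<bar> \<le> \<epsilon>)"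
    using params(2-5) assms(7) unfolding weight_def by linarith
  ultimately show ?thesis using params(1) by (auto simp: close_def)
qed

text \<open>Discarding entries between different kinds makes the product vanish for \<open>x\<close>
  and \<open>z\<close> of different kinds. For equal kinds no term is lost, by
  \<open>chain_params\<close>.\<close>

definition F' where "F' x y = (if same_kind x y then F x y else 0)"
definition G' where "G' y z = (if same_kind y z then G y z else 0)"

text \<open>Every contributing \<open>y\<close> is close to \<open>x\<close> or to \<open>z\<close>
  by \<open>chain_close\<close>, hence in \<open>T\<close>, so the sum over \<open>T\<close> agrees
  with the full matrix product.\<close>

lemma restricted_product:
  assumes x: "x \<in> significant" and z: "z \<in> significant" and le: "weight x \<le> weight z"
    and T: "finite T" "T \<subseteq> C" "neighbours x \<subseteq> T" "neighbours z \<subseteq> T"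
  shows "(\<Sum>y\<in>T. F' x y * G' y z) = (if x = z then 1 else 0)"
\<comment> \<open>If \<open>x\<close> and \<open>z\<close> differ and all terms vanish, the sum is
  0. Otherwise a chain, or \<open>x = z\<close>, gives the equal kinds and the parameter bounds
  needed to find \<open>r\<close>.\<close>
proof (cases "x = z \<or> (\<exists>y\<in>T. F' x y * G' y z \<noteq> 0)")
  case False
  then show ?thesis by (auto intro: sum.neutral)
next
  case True
  obtain p where p: "x \<in> B" "p \<in> fst x" "shift_pt (2 * \<epsilon>) p \<in> fst x" using significantE[OF x] .
  obtain q where q: "z \<in> B" "q \<in> fst z" "shift_pt (2 * \<epsilon>) q \<in> fst z" using significantE[OF z] .
  have kind: "same_kind x z"
    using True by (auto simp: F'_def G'_def same_kind_def split: if_splits)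
  have diff: "W (fst z) \<le> W (fst x) + 2 * \<epsilon>" "V (fst z) \<le> V (fst x) + 2 * \<epsilon>"
  proof -
    have "x = z \<or> (\<exists>y\<in>C. F x y \<noteq> 0 \<and> G y z \<noteq> 0)"
      using True T(2) by (fastforce simp: F'_def G'_def split: if_splits)
    then show "W (fst z) \<le> W (fst x) + 2 * \<epsilon>" "V (fst z) \<le> V (fst x) + 2 * \<epsilon>"
      using chain_params[OF p(1) _ q(1) _ _ kind] eps by fastforce+
  qed
  have xz: "fst x = blk (K (fst x)) (W (fst x)) (L (fst x)) (V (fst x))"
    "fst z = blk (K (fst x)) (W (fst z)) (L (fst x)) (V (fst z))"
    using blk_B[OF p(1)] blk_B[OF q(1)] kind by (simp_all add: same_kind_def)
  obtain r where r: "r \<in> fst x" "shift_pt (2 * \<epsilon>) r \<in> fst z"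
    using blk_shift_meets[of p "K (fst x)" "W (fst x)" "L (fst x)" "V (fst x)" \<epsilon> q "W (fst z)" "V (fst z)"]
      p q diff eps le xz unfolding weight_def by metis
  let ?Y = "{y \<in> C. shift_pt \<epsilon> r \<in> fst y}"
  have "r \<in> U_poset" using r(1) xz(1) by (auto simp: blk_def U_poset_def)
  then have Y: "finite ?Y" using fin U_poset_shift[OF eps] by blast
  have chain: "y \<in> T" "y \<in> ?Y" "same_kind x y" "same_kind y z"
    if y: "y \<in> C" "F x y \<noteq> 0" "G y z \<noteq> 0" for y
  proof -
    note params = chain_params[OF p(1) y(1) q(1) y(2,3) kind]
    show "y \<in> T"
      using chain_close[OF p(1) y(1) q(1) y(2,3) kind le] T y(1) by (auto simp: neighbours_def)
    show "same_kind x y" "same_kind y z"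
      using params(1) kind by (simp_all add: same_kind_def)
    have "fst y = blk (K (fst x)) (W (fst y)) (L (fst x)) (V (fst y))"
      using blk_C[OF y(1)] params(1) by (simp add: same_kind_def)
    then show "y \<in> ?Y"
      using blk_between[of r "K (fst x)" "W (fst x)" "L (fst x)" "V (fst x)" \<epsilon> "W (fst z)" "V (fst z)"
          "W (fst y)" "V (fst y)"] r xz eps params(2-5) y(1) by auto
  qed
  \<comment> \<open>Both sums effectively run over the \<open>y\<close> with \<open>F x y\<close>
    and \<open>G y z\<close> nonzero; \<open>chain\<close> puts these into \<open>T\<close> and into
    \<open>?Y\<close>.\<close>
  have "(\<Sum>y\<in>T. F' x y * G' y z) = (\<Sum>y\<in>T \<inter> ?Y. F x y * G y z)"
  proof (rule sum.mono_neutral_cong_right)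
    show "\<forall>y\<in>T - T \<inter> ?Y. F' x y * G' y z = 0"
      using chain(2) T(2) by (auto simp: F'_def G'_def)
    show "F' x y * G' y z = F x y * G y z" if "y \<in> T \<inter> ?Y" for y
      using chain(3,4)[of y] that T(2) by (auto simp: F'_def G'_def)
  qed (use T in auto)
  also have "\<dots> = (\<Sum>y\<in>?Y. F x y * G y z)"
    by (rule sum.mono_neutral_left[OF Y]) (use chain(1) in auto)
  also have "\<dots> = (if x = z then 1 else 0)"
    using FG[OF p(1) q(1) r] by simp
  finally show ?thesis .
qed

text \<open>With fewer neighbours than blocks, the rows of \<open>F'\<close> satisfy a nontrivial
  linear relation \<open>c\<close>. Multiplying it by the column of \<open>G'\<close> at a block
  \<open>z\<close> of largest weight in the support of \<open>c\<close> isolates \<open>c z\<close>,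
  which would then be 0.\<close>

lemma hall_neighbours: "hall significant neighbours"
  unfolding hall_def
proof (intro allI impI)
  fix S assume S: "S \<subseteq> significant" "finite S"
  let ?T = "\<Union> (neighbours ` S)"
  have T: "finite ?T" "?T \<subseteq> C" using S finite_neighbours by (auto simp: neighbours_def)
  show "card S \<le> card ?T"
  proof (rule ccontr)
    assume "\<not> card S \<le> card ?T"
    then obtain c where c: "\<exists>x\<in>S. c x \<noteq> 0" "\<forall>y\<in>?T. (\<Sum>x\<in>S. c x * F' x y) = 0"
      using homogeneous_system_nontrivial_solution[OF T(1) S(2), of F'] by auto
    let ?S = "{x \<in> S. c x \<noteq> 0}"
    \<comment> \<open>\<open>restricted_product\<close> requires
      \<open>weight x \<le> weight z\<close>, hence the maximum. Ties do no harm, since distinct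
      blocks of equal weight have product 0.\<close>
    define m where "m = Max (weight ` ?S)"
    have fS: "finite ?S" "?S \<noteq> {}" using S c(1) by auto
    then have "m \<in> weight ` ?S" unfolding m_def by (intro Max_in) auto
    then obtain z where z: "z \<in> ?S" "m = weight z" by auto
    have max: "weight x \<le> weight z" if "x \<in> ?S" for x
      using Max_ge[of "weight ` ?S" "weight x"] fS(1) that z(2) unfolding m_def by simp
    have "0 = (\<Sum>y\<in>?T. (\<Sum>x\<in>S. c x * F' x y) * G' y z)"
      by (rule sum.neutral[symmetric]) (use c(2) in auto)
    also have "\<dots> = (\<Sum>x\<in>S. c x * (\<Sum>y\<in>?T. F' x y * G' y z))"
      by (simp only: sum_distrib_left sum_distrib_right mult.assoc) (rule sum.swap)
    also have "\<dots> = (\<Sum>x\<in>S. if x = z then c z else 0)"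
    proof (rule sum.cong[OF refl])
      fix x assume x: "x \<in> S"
      show "c x * (\<Sum>y\<in>?T. F' x y * G' y z) = (if x = z then c z else 0)"
      proof (cases "c x = 0")
        case True
        then show ?thesis using z by auto
      next
        case False
        then have "(\<Sum>y\<in>?T. F' x y * G' y z) = (if x = z then 1 else 0)"
          using x z S max[of x] T by (intro restricted_product) auto
        then show ?thesis by simp
      qed
    qed
    also have "\<dots> = c z" using z S by simp
    finally show False using z by simp
  qed
qed

lemma significant_injection:
  obtains h where "inj_on h significant" "\<And>x. x \<in> significant \<Longrightarrow> h x \<in> C \<and> close x (h x)"
  using hall_infinite[OF finite_neighbours hall_neighbours] by (auto simp: neighbours_def)

end

section \<open>From the two halves to the matching of barcodes\<close>

lemma half_interleaving_of_U_interleaving: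
  fixes f :: "ropr \<Rightarrow> (ropr set \<times> 'i \<Rightarrow> 'k::field) \<Rightarrow> ropr set \<times> 'j \<Rightarrow> 'k"
  assumes eps: "0 \<le> \<epsilon>" and fg: "U_interleaving \<epsilon> (bsum B) (bsum C) f g"
    and rep_B: "\<And>x. x \<in> B \<Longrightarrow> represents (fst x) (K (fst x)) (W (fst x)) (L (fst x)) (V (fst x))"
    and rep_C: "\<And>y. y \<in> C \<Longrightarrow> represents (fst y) (K (fst y)) (W (fst y)) (L (fst y)) (V (fst y))"
    and fin: "\<And>p. p \<in> U_poset \<Longrightarrow> finite {y \<in> C. p \<in> fst y}"
  shows "half_interleaving \<epsilon> B C (coeff \<epsilon> f) (coeff \<epsilon> g) K L W V"
proof -
  have f: "bsum_morphism \<epsilon> B C f" and g: "bsum_morphism \<epsilon> C B g"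
    using eps fg rep_B rep_C
    by (unfold_locales; fastforce simp: U_interleaving_def represents_def)+
  show ?thesis
  proof
    show "connects \<epsilon> (fst x) (fst y)" if "x \<in> B" "y \<in> C" "coeff \<epsilon> f x y \<noteq> 0" for x y
      using bsum_morphism.coeff_connects[OF f that] .
    show "connects \<epsilon> (fst y) (fst z)" if "y \<in> C" "z \<in> B" "coeff \<epsilon> g y z \<noteq> 0" for y z
      using bsum_morphism.coeff_connects[OF g that] .
    show "(\<Sum>y | y \<in> C \<and> shift_pt \<epsilon> p \<in> fst y. coeff \<epsilon> f x y * coeff \<epsilon> g y z)
        = (if x = z then 1 else 0)"
      if x: "x \<in> B" and z: "z \<in> B" and p: "p \<in> fst x" "shift_pt (2 * \<epsilon>) p \<in> fst z" for x z p
    proof (rule coeff_product[OF f g fg _ x p(1) z p(2)])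
      have "p \<in> U_poset" using bsum_morphism.B_sub_U[OF f x p(1)] .
      then show "finite {y \<in> C. shift_pt \<epsilon> p \<in> fst y}" using fin U_poset_shift[OF eps] by blast
    qed
  qed (use eps rep_B rep_C fin in auto)
qed

text \<open>By convexity a block that meets its shift by \<open>\<delta>\<close> meets every smaller
  one; this leads from \<open>5 * \<epsilon>\<close> to \<open>2 * \<epsilon>\<close>.\<close>

lemma nontrivial_part_persistent:
  assumes "\<And>x. x \<in> D \<Longrightarrow> is_block (fst x)" "0 \<le> \<gamma>" "\<gamma> \<le> \<delta>"
  shows "nontrivial_part TYPE('k::field) \<delta> D \<subseteq> shift_persistent \<gamma> D"
proof
  fix x assume x: "x \<in> nontrivial_part TYPE('k) \<delta> D"
  then obtain k w l v where "fst x = blk k w l v"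
    using assms(1) block_represented[of "fst x"] by (auto simp: nontrivial_part_def represents_def)
  then have "\<not> trivial_interval TYPE('k) \<gamma> (fst x)"
    using x blk_nontrivial_mono[OF _ assms(2,3), where 'k = 'k] by (simp add: nontrivial_part_def)
  then show "x \<in> shift_persistent \<gamma> D"
    using x by (auto simp: nontrivial_part_def trivial_interval_iff shift_persistent_def)
qed

text \<open>Sets of type \<open>Type_c\<close> are upper sets, so shifts never leave them.\<close>

lemma type_c_persistent:
  assumes "\<And>x. x \<in> D \<Longrightarrow> fst x \<noteq> {}" "0 \<le> \<delta>"
  shows "type_part Type_c D \<subseteq> shift_persistent \<delta> D"
proof
  fix x assume x: "x \<in> type_part Type_c D"
  then have "\<exists>p\<in>fst x. shift_pt \<delta> p \<in> fst x"
    using type_c_shift_closed[of "fst x" _ \<delta>] assms unfolding type_part_def by blast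
  then show "x \<in> shift_persistent \<delta> D" using x by (simp add: type_part_def shift_persistent_def)
qed

theorem theorem3p3:
  fixes M :: "(ropr, 'k::field, 'v::ab_group_add) pmod"
    and N :: "(ropr, 'k, 'w::ab_group_add) pmod"
    and BM :: "(ropr, 'i) barcode"
    and BN :: "(ropr, 'j) barcode"
    and \<epsilon> :: real
  assumes "\<epsilon> \<ge> 0"
    and "persistence_module U_poset M" and "persistence_module U_poset N"
    and "pfd U_poset M" and "pfd U_poset N"
    and "is_block_barcode M BM" and "is_block_barcode N BN"
    and "interleaved \<epsilon> (extend_zero U_poset M) (extend_zero U_poset N)"
  shows "\<exists>\<sigma>. matching BM BN \<sigma> \<and>
    type_part Type_c BM
      \<union> nontrivial_part TYPE('k) (5 * \<epsilon>) (type_part Type_o BM)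
      \<union> nontrivial_part TYPE('k) (2 * \<epsilon>) (type_part Type_co BM)
      \<union> nontrivial_part TYPE('k) (2 * \<epsilon>) (type_part Type_oc BM) \<subseteq> dom \<sigma> \<and>
    type_part Type_c BN
      \<union> nontrivial_part TYPE('k) (5 * \<epsilon>) (type_part Type_o BN)
      \<union> nontrivial_part TYPE('k) (2 * \<epsilon>) (type_part Type_co BN)
      \<union> nontrivial_part TYPE('k) (2 * \<epsilon>) (type_part Type_oc BN) \<subseteq> ran \<sigma> \<and>
    (\<forall>x y. \<sigma> x = Some y \<longrightarrow>
       interleaved_intervals TYPE('k) \<epsilon> (fst x) (fst y) \<and>
       (\<exists>t. has_type t (fst x) \<and> has_type t (fst y))) \<and>
    eps_matching TYPE('k) (5 / 2 * \<epsilon>) BM BN \<sigma>"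
proof -
  have BM: "isomorphic U_poset M (bsum BM)" "\<And>x. x \<in> BM \<Longrightarrow> is_block (fst x) \<and> fst x \<noteq> {}"
    using assms(6) by (auto simp: is_block_barcode_def is_barcode_def is_interval_of_def)
  have BN: "isomorphic U_poset N (bsum BN)" "\<And>x. x \<in> BN \<Longrightarrow> is_block (fst x) \<and> fst x \<noteq> {}"
    using assms(7) by (auto simp: is_block_barcode_def is_barcode_def is_interval_of_def)
  \<comment> \<open>Endpoints are chosen once per set, so that both barcodes and both directions use
    the same parameters.\<close>
  have "\<forall>J. \<exists>k w l v. is_block J \<longrightarrow> represents J k w l v" using block_represented by blast
  then obtain K W L V where rep: "\<And>J. is_block J \<Longrightarrow> represents J (K J) (W J) (L J) (V J)"
    by metis
  obtain f0 g0 where "U_interleaving \<epsilon> M N f0 g0"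
    using interleaved_extend_zero[OF assms(1,8)] .
  then obtain f g where fg: "U_interleaving \<epsilon> (bsum BM :: (ropr, 'k, _) pmod) (bsum BN) f g"
    using U_interleaving_isomorphic[OF assms(1) _ BM(1) BN(1)] by blast
  have finM: "finite {x \<in> BM. p \<in> fst x}" and finN: "finite {y \<in> BN. p \<in> fst y}"
    if "p \<in> U_poset" for p
    using pfd_barcode_finite[OF assms(2,4) BM(1) that] pfd_barcode_finite[OF assms(3,5) BN(1) that]
    by auto
  interpret MN: half_interleaving \<epsilon> BM BN "coeff \<epsilon> f" "coeff \<epsilon> g" K L W V
    using half_interleaving_of_U_interleaving[OF assms(1) fg] rep BM(2) BN(2) finN by blast
  interpret NM: half_interleaving \<epsilon> BN BM "coeff \<epsilon> g" "coeff \<epsilon> f" K L W V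
    using half_interleaving_of_U_interleaving[OF assms(1) fg[THEN U_interleaving_sym]]
      rep BM(2) BN(2) finM by blast
  obtain h where h: "inj_on h MN.significant"
    "\<And>x. x \<in> MN.significant \<Longrightarrow> h x \<in> BN \<and> MN.close x (h x)"
    using MN.significant_injection by blast
  obtain h' where h': "inj_on h' NM.significant"
    "\<And>y. y \<in> NM.significant \<Longrightarrow> h' y \<in> BM \<and> NM.close y (h' y)"
    using NM.significant_injection by blast
  obtain \<sigma> where \<sigma>: "matching BM BN \<sigma>" "MN.significant \<subseteq> dom \<sigma>" "NM.significant \<subseteq> ran \<sigma>"
    "\<And>x y. \<sigma> x = Some y \<Longrightarrow> MN.close x y"
  proof (rule matching_covering_both[of h MN.significant BN MN.close h' NM.significant BM])
    show "MN.significant \<subseteq> BM" "NM.significant \<subseteq> BN"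
      by (auto simp: shift_persistent_def)
    show "h' y \<in> BM \<and> MN.close (h' y) y" if "y \<in> NM.significant" for y
      using h'(2)[OF that] MN.close_sym by blast
  qed (use h h'(1) in auto)
  \<comment> \<open>The slack \<open>\<delta>\<close> is taken as \<open>\<epsilon>\<close> for the
    matched pairs and as \<open>5 / 2 * \<epsilon>\<close> for \<open>eps_matching\<close>.\<close>
  have matched: "interleaved_intervals TYPE('k) \<delta> (fst x) (fst y)
      \<and> (\<exists>t. has_type t (fst x) \<and> has_type t (fst y))"
    if xy: "\<sigma> x = Some y" and "\<epsilon> \<le> \<delta>" for x y \<delta>
  proof -
    have B: "x \<in> BM" "y \<in> BN" using \<sigma>(1) xy by (auto simp: matching_def ranI)
    have close: "MN.close x y" using \<sigma>(4)[OF xy] .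
    have "has_type (block_type_of (K (fst x)) (L (fst x))) (fst x)"
      using represents_has_type[OF rep] BM(2) B by blast
    moreover have "has_type (block_type_of (K (fst x)) (L (fst x))) (fst y)"
      using represents_has_type[OF rep] BN(2) B close
      unfolding MN.close_def MN.same_kind_def by metis
    ultimately show ?thesis
      using close_blocks_interleaved[OF close_blocks_mono[OF MN.close_close_blocks[OF B close]]] that(2)
      by blast
  qed
  have nontrivial: "nontrivial_part TYPE('k) \<delta> D \<subseteq> dom \<sigma>" if "2 * \<epsilon> \<le> \<delta>" "D \<subseteq> BM" for \<delta> D
    using nontrivial_part_persistent[where 'k = 'k, OF _ _ that(1), of BM] assms(1) BM(2) \<sigma>(2) that(2)
    unfolding nontrivial_part_def by fastforce
  have nontrivial': "nontrivial_part TYPE('k) \<delta> D \<subseteq> ran \<sigma>" if "2 * \<epsilon> \<le> \<delta>" "D \<subseteq> BN" for \<delta> D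
    using nontrivial_part_persistent[where 'k = 'k, OF _ _ that(1), of BN] assms(1) BN(2) \<sigma>(3) that(2)
    unfolding nontrivial_part_def by fastforce
  have c: "type_part Type_c BM \<subseteq> dom \<sigma>" "type_part Type_c BN \<subseteq> ran \<sigma>"
    using type_c_persistent[of BM "2 * \<epsilon>"] type_c_persistent[of BN "2 * \<epsilon>"]
      BM(2) BN(2) \<sigma>(2,3) assms(1) by auto
  have "eps_matching TYPE('k) (5 / 2 * \<epsilon>) BM BN \<sigma>"
    unfolding eps_matching_def
    using \<sigma>(1) nontrivial[of _ BM] nontrivial'[of _ BN] matched[of _ _ "5 / 2 * \<epsilon>"] assms(1)
    by auto
  then show ?thesis
    using \<sigma>(1) c nontrivial nontrivial' matched[of _ _ \<epsilon>] assms(1)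
    by (intro exI[of _ \<sigma>] conjI Un_least allI impI) (auto simp: type_part_def)
qed

end
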